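(* Assume that: (i) for each $i$, $X_i$ is convex, $f_i$ and every component of $g_i$ are convex on $X_i$, $h_i$ is affine on $X_i$, and problem (CC) has at least one optimal solution; (ii) (Slater) there exist $\tilde x_i\in\mathrm{relint}\,X_i$, $i=1,\dots,N$, with $\sum_{i=1}^N g_i(\tilde x_i)<\mathbf 0_m$ (componentwise) and $\sum_{i=1}^N h_i(\tilde x_i)=\mathbf 0_p$; (iii) $P_A,P_H,P_{\tilde H}\in\mathbb R^{N\times N}$ are symmetric positive semidefinite with $P_A+\rho P_H\succ 0$, $P_H\succeq P_{\tilde H}$ and $\mathrm{Null}(P_H)=\mathrm{Null}(P_{\tilde H})=\mathrm{span}(\mathbf 1_N)$; (iv) $P_A+\rho P_H$ is diagonal. Let $\{\mathbf x^k,\mathbf y^k,\mathbf z^k\}_{k\ge0}$ be generated by Pro-DUCA. Then for all $k\ge1$, $$-\frac{R_1'}{k}\le f(\bar{\mathbf x}^k)-f(\mathbf x^\star)\le\frac{R_2'}{k},$$ where $R_1'=C_1(\|\mathbf y^0\|_A+C_1+C_2)$, $R_2'=\frac1{2\rho}\|\mathbf v^0-\mathbf v^\star\|_{\tilde H^\dagger}^2+\frac12\|\mathbf y^0\|_A^2+\frac\alpha2\|\mathbf x^0-\mathbf x^\star\|^2$, $C_1=\sqrt{N\lambda_1(P_A)}\,\|y^\star\|$ and $C_2=\Big((\|\mathbf y^0\|_A+C_1)^2+\alpha\|\mathbf x^0-\mathbf x^\star\|^2+\frac1\rho\|\mathbf v^0-\mathbf v^\star\|_{\tilde H^\dagger}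^2\Big)^{1/2}$.
   Context: Problem (CC): minimize $\sum_{i=1}^N f_i(x_i)$ over $x_i\in X_i\subseteq\mathbb R^{d_i}$, $i=1,\dots,N$, subject to $\sum_{i=1}^N g_i(x_i)\le\mathbf 0_m$ and $\sum_{i=1}^N h_i(x_i)=\mathbf 0_p$, where $f_i:\mathbb R^{d_i}\to\mathbb R$, $g_i:\mathbb R^{d_i}\to\mathbb R^m$, $h_i:\mathbb R^{d_i}\to\mathbb R^p$. Write $\mathbf x=[x_1^T,\dots,x_N^T]^T$, $X=X_1\times\dots\times X_N$, $f(\mathbf x)=\sum_i f_i(x_i)$, $\tilde g(\mathbf x)=[g_1(x_1)^T,h_1(x_1)^T,\dots,g_N(x_N)^T,h_N(x_N)^T]^T\in\mathbb R^{N(m+p)}$. Under (i)-(ii) there exists a primal-dual optimal pair $(\mathbf x^\star,(\mu^\star,\lambda^\star))$ with $\mu^\star\in\mathbb R^m_+$, $\lambda^\star\in\mathbb R^p$: $\mathbf x^\star$ is optimal for (CC), $(\mu^\star,\lambda^\star)$ is optimal for the Lagrange dual (maximize $\inf_{\mathbf x\in X}f(\mathbf x)+\langle\mu,\sum_i g_i(x_i)\rangle+\langle\lambda,\sum_i h_i(x_i)\rangle$ over $\mu\in\mathbb R^m_+$, $\lambda\in\mathbb R^p$), there is zero duality gap, and $\mathbf x^\star\in\arg\min_{\mathbf x\in X}f(\mathbf x)+\langle\mu^\star,\sum_i g_i(x_i)\rangle+\langle\lambda^\star,\sum_i h_i(x_i)\rangle$. Fix such a pair. Vectors $\mathbf y\in\mathbb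 R^{N(m+p)}$ are partitioned as $\mathbf y=[y_1^T,\dots,y_N^T]^T$, $y_i=[\mu_i^T,\lambda_i^T]^T$, $\mu_i\in\mathbb R^m$, $\lambda_i\in\mathbb R^p$; $\mathcal K=\{\mathbf y:\mu_i\in\mathbb R^m_+\ \forall i\}$. $\mathcal P_{\mathcal K}$ is Euclidean projection onto $\mathcal K$. $\rho>0$ and $\alpha>0$ are parameters; $A=P_A\otimes I_{m+p}$, $H=P_H\otimes I_{m+p}$, $\tilde H=P_{\tilde H}\otimes I_{m+p}$, $D=A+\rho H$. $\|\cdot\|$ is the Euclidean norm, $\|z\|_M=\sqrt{z^TMz}$ for symmetric positive semidefinite $M$, $M^\dagger$ is the Moore–Penrose pseudoinverse, $\lambda_1(\cdot)$ is the largest eigenvalue. Pro-DUCA: from arbitrary $\mathbf x^0\in\mathbb R^{\sum_i d_i}$, $\mathbf y^0\in\mathcal K$, $\mathbf z^0\in\mathbb R^{N(m+p)}$, for $k\ge0$: $\mathbf x^{k+1}=\arg\min_{\mathbf x\in X}\{f(\mathbf x)+\frac12\|\mathcal P_{\mathcal K}[A\mathbf y^k-\tilde H^{1/2}\mathbf z^k+\tilde g(\mathbf x)]\|_{D^{-1}}^2+\frac\alpha2\|\mathbf x-\mathbf x^k\|^2\}$; $\mathbf y^{k+1}=\mathcal P_{\mathcal K}[D^{-1}(A\mathbf y^k-\tilde H^{1/2}\mathbf z^k+\tilde g(\mathbf x^{k+1}))]$; $\mathbf z^{k+1}=\mathbf z^k+\rho\tilde H^{1/2}\mathbf y^{k+1}$.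 Further notation: $y^\star=[(\mu^\star)^T,(\lambda^\star)^T]^T$, $\mathbf z^\star=(\tilde H^{1/2})^\dagger\tilde g(\mathbf x^\star)$, $\mathbf v^k=\tilde H^{1/2}\mathbf z^k$, $\mathbf v^\star=\tilde H^{1/2}\mathbf z^\star$, $\bar{\mathbf x}^k=\frac1k\sum_{l=1}^k\mathbf x^l$. *)

theory Defs
  imports "HOL-Analysis.Analysis"
begin

definition psd :: "real^'n^'n \<Rightarrow> bool" where
  "psd M \<longleftrightarrow> transpose M = M \<and> (\<forall>x. 0 \<le> x \<bullet> (M *v x))"

definition posdef :: "real^'n^'n \<Rightarrow> bool" where
  "posdef M \<longleftrightarrow> transpose M = M \<and> (\<forall>x. x \<noteq> 0 \<longrightarrow> 0 < x \<bullet> (M *v x))"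

definition diagonal_matrix :: "real^'n^'n \<Rightarrow> bool" where
  "diagonal_matrix M \<longleftrightarrow> (\<forall>i j. i \<noteq> j \<longrightarrow> M $ i $ j = 0)"

definition null_space :: "real^'n^'m \<Rightarrow> (real^'n) set" where
  "null_space M = {x. M *v x = 0}"

definition eigvals :: "real^'n^'n \<Rightarrow> real set" where
  "eigvals M = {l. \<exists>v. v \<noteq> 0 \<and> M *v v = l *\<^sub>R v}"

definition lambda_max :: "real^'n^'n \<Rightarrow> real" where
  "lambda_max M = Max (eigvals M)"

definition psd_sqrt :: "real^'n^'n \<Rightarrow> real^'n^'n" where
  "psd_sqrt M = (THE S. psd S \<and> S ** S = M)"

text \<open>The Moore--Penrose pseudoinverse, characterised by the four Penrose equations.\<close>

definition pinv :: "real^'n^'m \<Rightarrow> real^'m^'n" where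
  "pinv M = (THE B. M ** B ** M = M \<and> B ** M ** B = B \<and>
                    transpose (M ** B) = M ** B \<and> transpose (B ** M) = B ** M)"

definition kron :: "real^'b^'a \<Rightarrow> real^'d^'c \<Rightarrow> real^('b \<times> 'd)^('a \<times> 'c)" where
  "kron P Q = (\<chi> r s. P $ fst r $ fst s * Q $ snd r $ snd s)"

definition wnorm :: "real^'n^'n \<Rightarrow> real^'n \<Rightarrow> real" where
  "wnorm M z = sqrt (z \<bullet> (M *v z))"

definition affine_map_on :: "'a::real_vector set \<Rightarrow> ('a \<Rightarrow> 'b::real_vector) \<Rightarrow> bool" where
  "affine_map_on S h \<longleftrightarrow> (\<exists>L c. linear L \<and> (\<forall>x\<in>S. h x = L x + c))"

text \<open>
  The agents are the elements of the type \<open>'n\<close>, so \<open>N = CARD('n)\<close>. The dimensions of the local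
  decision spaces differ from agent to agent: the stacked decision vector is indexed by
  \<open>'d\<close>, and \<open>b :: 'd \<Rightarrow> 'n\<close> names the agent to which a coordinate belongs. The local space of
  agent \<open>i\<close>, of dimension \<open>card {j. b j = i}\<close>, is identified with the coordinate subspace
  \<open>block_space b i\<close>; local sets are subsets of that subspace and local functions are only ever
  evaluated on it.
\<close>

definition block_space :: "('d \<Rightarrow> 'n) \<Rightarrow> 'n \<Rightarrow> (real^'d) set" where
  "block_space b i = {x. \<forall>j. b j \<noteq> i \<longrightarrow> x $ j = 0}"

definition block :: "('d \<Rightarrow> 'n) \<Rightarrow> 'n \<Rightarrow> real^'d \<Rightarrow> real^'d" where
  "block b i x = (\<chi> j. if b j = i then x $ j else 0)"

definition block_prod :: "('d \<Rightarrow> 'n) \<Rightarrow> ('n \<Rightarrow> (real^'d) set) \<Rightarrow> (real^'d) set" where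
  "block_prod b X = {x. \<forall>i. block b i x \<in> X i}"

definition block_sum ::
  "('d \<Rightarrow> 'n::finite) \<Rightarrow> ('n \<Rightarrow> real^'d \<Rightarrow> 'v::real_vector) \<Rightarrow> real^'d \<Rightarrow> 'v" where
  "block_sum b F x = (\<Sum>i\<in>UNIV. F i (block b i x))"

definition cc_feasible ::
  "('d \<Rightarrow> 'n::finite) \<Rightarrow> ('n \<Rightarrow> (real^'d) set) \<Rightarrow> ('n \<Rightarrow> real^'d \<Rightarrow> real^'m) \<Rightarrow>
   ('n \<Rightarrow> real^'d \<Rightarrow> real^'p) \<Rightarrow> real^'d \<Rightarrow> bool" where
  "cc_feasible b X g h x \<longleftrightarrow>
     x \<in> block_prod b X \<and> (\<forall>j. block_sum b g x $ j \<le> 0) \<and> block_sum b h x = 0"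

definition cc_optimal ::
  "('d \<Rightarrow> 'n::finite) \<Rightarrow> ('n \<Rightarrow> (real^'d) set) \<Rightarrow> ('n \<Rightarrow> real^'d \<Rightarrow> real) \<Rightarrow>
   ('n \<Rightarrow> real^'d \<Rightarrow> real^'m) \<Rightarrow> ('n \<Rightarrow> real^'d \<Rightarrow> real^'p) \<Rightarrow> real^'d \<Rightarrow> bool" where
  "cc_optimal b X f g h x \<longleftrightarrow> is_arg_min (block_sum b f) (cc_feasible b X g h) x"

definition slater ::
  "('n::finite \<Rightarrow> (real^'d) set) \<Rightarrow> ('n \<Rightarrow> real^'d \<Rightarrow> real^'m) \<Rightarrow>
   ('n \<Rightarrow> real^'d \<Rightarrow> real^'p) \<Rightarrow> bool" where
  "slater X g h \<longleftrightarrow>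
     (\<exists>xt. (\<forall>i. xt i \<in> rel_interior (X i)) \<and>
           (\<forall>j. (\<Sum>i\<in>UNIV. g i (xt i)) $ j < 0) \<and> (\<Sum>i\<in>UNIV. h i (xt i)) = 0)"

definition lagrangian ::
  "('d \<Rightarrow> 'n::finite) \<Rightarrow> ('n \<Rightarrow> real^'d \<Rightarrow> real) \<Rightarrow> ('n \<Rightarrow> real^'d \<Rightarrow> real^'m) \<Rightarrow>
   ('n \<Rightarrow> real^'d \<Rightarrow> real^'p) \<Rightarrow> real^'m \<Rightarrow> real^'p \<Rightarrow> real^'d \<Rightarrow> real" where
  "lagrangian b f g h \<mu> \<nu> x =
     block_sum b f x + \<mu> \<bullet> block_sum b g x + \<nu> \<bullet> block_sum b h x"

text \<open>The infimum may be \<open>-\<infinity>\<close>, hence the extended reals.\<close>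

definition dual_fun ::
  "('d \<Rightarrow> 'n::finite) \<Rightarrow> ('n \<Rightarrow> (real^'d) set) \<Rightarrow> ('n \<Rightarrow> real^'d \<Rightarrow> real) \<Rightarrow>
   ('n \<Rightarrow> real^'d \<Rightarrow> real^'m) \<Rightarrow> ('n \<Rightarrow> real^'d \<Rightarrow> real^'p) \<Rightarrow> real^'m \<Rightarrow> real^'p \<Rightarrow> ereal" where
  "dual_fun b X f g h \<mu> \<nu> = (INF x \<in> block_prod b X. ereal (lagrangian b f g h \<mu> \<nu> x))"

definition primal_dual_optimal ::
  "('d \<Rightarrow> 'n::finite) \<Rightarrow> ('n \<Rightarrow> (real^'d) set) \<Rightarrow> ('n \<Rightarrow> real^'d \<Rightarrow> real) \<Rightarrow>
   ('n \<Rightarrow> real^'d \<Rightarrow> real^'m) \<Rightarrow> ('n \<Rightarrow> real^'d \<Rightarrow> real^'p) \<Rightarrow>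
   real^'d \<Rightarrow> real^'m \<Rightarrow> real^'p \<Rightarrow> bool" where
  "primal_dual_optimal b X f g h x \<mu> \<nu> \<longleftrightarrow>
     cc_optimal b X f g h x \<and>
     is_arg_max (\<lambda>(\<mu>', \<nu>'). dual_fun b X f g h \<mu>' \<nu>') (\<lambda>(\<mu>', \<nu>'). \<forall>j. 0 \<le> \<mu>' $ j) (\<mu>, \<nu>) \<and>
     dual_fun b X f g h \<mu> \<nu> = ereal (block_sum b f x) \<and>
     is_arg_min (lagrangian b f g h \<mu> \<nu>) (\<lambda>x'. x' \<in> block_prod b X) x"

text \<open>
  A stacked dual vector is indexed by \<open>'n \<times> ('m + 'p)\<close>: coordinate \<open>(i, Inl j)\<close> is the \<open>j\<close>-th
  entry of \<open>\<mu>\<^sub>i\<close> and \<open>(i, Inr l)\<close> is the \<open>l\<close>-th entry of \<open>\<lambda>\<^sub>i\<close>.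
\<close>

definition stack :: "real^'m \<Rightarrow> real^'p \<Rightarrow> real^('m + 'p)" where
  "stack \<mu> \<nu> = (\<chi> c. case c of Inl j \<Rightarrow> \<mu> $ j | Inr l \<Rightarrow> \<nu> $ l)"

definition cone_K :: "(real^('n::finite \<times> ('m::finite + 'p::finite))) set" where
  "cone_K = {y. \<forall>i j. 0 \<le> y $ (i, Inl j)}"

definition gtilde ::
  "('d \<Rightarrow> 'n::finite) \<Rightarrow> ('n \<Rightarrow> real^'d \<Rightarrow> real^'m) \<Rightarrow> ('n \<Rightarrow> real^'d \<Rightarrow> real^'p) \<Rightarrow>
   real^'d \<Rightarrow> real^('n \<times> ('m + 'p))" where
  "gtilde b g h x =
     (\<chi> c. stack (g (fst c) (block b (fst c) x)) (h (fst c) (block b (fst c) x)) $ snd c)"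

text \<open>
  Existence of the primal minimiser in each iteration is part of the predicate: the local
  sets need not be closed. Its uniqueness follows from the proximal term.
\<close>

definition pro_duca ::
  "('d \<Rightarrow> 'n::finite) \<Rightarrow> ('n \<Rightarrow> (real^'d) set) \<Rightarrow> ('n \<Rightarrow> real^'d \<Rightarrow> real) \<Rightarrow>
   ('n \<Rightarrow> real^'d \<Rightarrow> real^'m) \<Rightarrow> ('n \<Rightarrow> real^'d \<Rightarrow> real^'p) \<Rightarrow> real \<Rightarrow> real \<Rightarrow>
   real^('n \<times> ('m + 'p))^('n \<times> ('m + 'p)) \<Rightarrow>
   real^('n \<times> ('m + 'p))^('n \<times> ('m + 'p)) \<Rightarrow>
   real^('n \<times> ('m + 'p))^('n \<times> ('m + 'p)) \<Rightarrow>
   (nat \<Rightarrow> real^'d) \<Rightarrow> (nat \<Rightarrow> real^('n \<times> ('m + 'p))) \<Rightarrow> (nat \<Rightarrow> real^('n \<times> ('m + 'p))) \<Rightarrow> bool"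
where
  "pro_duca b X f g h \<rho> \<alpha> A H Ht x y z \<longleftrightarrow>
     (let D = A + \<rho> *\<^sub>R H; S = psd_sqrt Ht in
        y 0 \<in> cone_K \<and>
        (\<forall>k.
           is_arg_min
             (\<lambda>u. block_sum b f u
                  + 1/2 * (wnorm (matrix_inv D)
                             (closest_point cone_K (A *v y k - S *v z k + gtilde b g h u)))\<^sup>2
                  + \<alpha>/2 * (norm (u - x k))\<^sup>2)
             (\<lambda>u. u \<in> block_prod b X) (x (Suc k)) \<and>
           y (Suc k) = closest_point cone_K
             (matrix_inv D *v (A *v y k - S *v z k + gtilde b g h (x (Suc k)))) \<and>
           z (Suc k) = z k + \<rho> *\<^sub>R (S *v y (Suc k))))"

end

theory Submission
  imports Defs
begin

text \<open>
  Since \<open>D\<close> is diagonal and positive, it commutes with the projection onto \<open>K\<close>, so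
  \<open>D y\<^sup>+\<close>, where \<open>+\<close> marks the step from \<open>k\<close> to \<open>k + 1\<close>, is the projection of \<open>q = A y\<^sup>k - v\<^sup>k + g(x\<^sup>+)\<close>, where \<open>g\<close> is the stacked constraint
  map. Two first-order conditions follow: \<open>x\<^sup>+\<close> minimises \<open>f + \<langle>y\<^sup>+, g\<rangle>\<close> over \<open>X\<close> up to the
  proximal term, and \<open>q - D y\<^sup>+\<close> is polar to \<open>K\<close> and orthogonal to \<open>y\<^sup>+\<close>. Testing the first
  with \<open>x\<^sup>*\<close> and the second with a consensus vector \<open>a\<close> in \<open>K\<close>, which \<open>H\<close> and the square root
  of \<open>Ht\<close> annihilate, gives
  \<open>f(x\<^sup>+) - f(x\<^sup>*) + \<langle>a, g(x\<^sup>+)\<rangle> \<le> E\<^sub>k - E\<^sub>k\<^sub>+\<^sub>1\<close> for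
  \<open>E\<^sub>k = \<alpha>/2 \<parallel>x\<^sup>k - x\<^sup>*\<parallel>\<^sup>2 + 1/2 \<parallel>y\<^sup>k - a\<parallel>\<^sub>A\<^sup>2 + 1/(2\<rho>) \<parallel>v\<^sup>k - v\<^sup>*\<parallel>\<^sup>2\<close>, the last norm being weighted by the
  pseudoinverse of \<open>Ht\<close>. Telescoping with \<open>a = 0\<close> and convexity yield the upper bound. With \<open>a\<close>
  the consensus copy of \<open>y\<^sup>*\<close>, the left-hand sides are nonnegative by the saddle point property,
  which bounds \<open>\<parallel>y\<^sup>k\<parallel>\<^sub>A\<close> by \<open>C1 + C2\<close>. Polarity also gives
  \<open>\<langle>a, g(x\<^sup>+)\<rangle> \<le> \<langle>a, A (y\<^sup>+ - y\<^sup>k)\<rangle>\<close>; summing this and using the saddle point property at the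
  averaged iterate gives the lower bound.
\<close>

section \<open>Symmetric matrices\<close>

lemma symmetric_inner:
  fixes M :: "real^'n^'n"
  assumes "transpose M = M"
  shows "(M *v x) \<bullet> y = x \<bullet> (M *v y)"
  by (metis assms dot_lmul_matrix transpose_matrix_vector)

lemma symmetric_of_inner:
  fixes M :: "real^'n^'n"
  assumes "\<And>x y. (M *v x) \<bullet> y = x \<bullet> (M *v y)"
  shows "transpose M = M"
proof -
  have "x \<bullet> (transpose M *v y) = x \<bullet> (M *v y)" for x y
    using assms[of x y] by (metis dot_lmul_matrix inner_commute transpose_matrix_vector)
  then have "transpose M *v y = M *v y" for y
    using vector_eq_ldot by blast
  then show ?thesis by (simp add: matrix_eq)
qed

text \<open>Take a maximiser \<open>v\<close> of the quadratic form \<open>q\<close> on the unit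
  sphere of \<open>V\<close>. The residual \<open>r = M *v v - q v *\<^sub>R v\<close> lies in
  \<open>V\<close>, and moving \<open>v\<close> by \<open>t *\<^sub>R r\<close> changes
  \<open>q x - q v * (x \<bullet> x)\<close> by \<open>2 * t * (r \<bullet> r)\<close> up to order
  \<open>t^2\<close>. Maximality keeps this nonpositive for all small \<open>t\<close>, which forces
  \<open>r = 0\<close>.\<close>

lemma symmetric_eigenvector_in_subspace:
  fixes M :: "real^'n^'n"
  assumes sym: "transpose M = M" and V: "subspace V" and inv: "\<And>x. x \<in> V \<Longrightarrow> M *v x \<in> V"
    and w: "w \<in> V" "w \<noteq> 0"
  obtains v l where "v \<in> V" "norm v = 1" "M *v v = l *\<^sub>R v"
proof -
  define q where "q x = x \<bullet> (M *v x)" for x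
  have comp: "compact (V \<inter> sphere 0 1)"
    using closed_subspace[OF V] compact_sphere by (simp add: closed_Int_compact)
  have "w /\<^sub>R norm w \<in> V \<inter> sphere 0 1"
    using w V by (simp add: subspace_scale)
  then have ne: "V \<inter> sphere 0 1 \<noteq> {}" by blast
  have "continuous_on (V \<inter> sphere 0 1) q"
    unfolding q_def by (intro continuous_intros linear_continuous_on_compose matrix_vector_mul_linear)
  then obtain v where v: "v \<in> V" "norm v = 1" and vmax: "\<And>x. x \<in> V \<Longrightarrow> norm x = 1 \<Longrightarrow> q x \<le> q v"
    using continuous_attains_sup[OF comp ne] by force
  have bound: "q x \<le> q v * (x \<bullet> x)" if "x \<in> V" for x
  proof (cases "x = 0")
    case False
    then have "q (x /\<^sub>R norm x) \<le> q v"
      using that V by (intro vmax) (auto simp: subspace_scale)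
    then show ?thesis using False
      by (simp add: q_def matrix_vector_mult_scaleR field_simps power2_eq_square flip: power2_norm_eq_inner)
  qed (simp add: q_def)
  define r where "r = M *v v - q v *\<^sub>R v"
  have rV: "r \<in> V" unfolding r_def using v V inv by (simp add: subspace_diff subspace_scale)
  define c where "c = q v * (r \<bullet> r) - q r"
  have vv: "v \<bullet> v = 1" using v by (simp add: dot_square_norm)
  have "2 * (r \<bullet> r) \<le> t * c" if "t > 0" for t
  proof -
    have *: "q (v + t *\<^sub>R r) \<le> q v * ((v + t *\<^sub>R r) \<bullet> (v + t *\<^sub>R r))"
      using v rV V by (intro bound) (simp add: subspace_add subspace_scale)
    have q_exp: "q (v + t *\<^sub>R r) = q v + 2 * t * (r \<bullet> (M *v v)) + t\<^sup>2 * q r"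
      using symmetric_inner[OF sym, of v r]
      by (simp add: q_def algebra_simps matrix_vector_right_distrib matrix_vector_mult_scaleR
          inner_commute power2_eq_square)
    have n_exp: "(v + t *\<^sub>R r) \<bullet> (v + t *\<^sub>R r) = 1 + 2 * t * (r \<bullet> v) + t\<^sup>2 * (r \<bullet> r)"
      using vv by (simp add: algebra_simps inner_commute power2_eq_square)
    have rr: "r \<bullet> (M *v v) - q v * (r \<bullet> v) = r \<bullet> r"
      by (simp add: r_def inner_diff_right)
    have "2 * t * (r \<bullet> (M *v v) - q v * (r \<bullet> v)) \<le> t\<^sup>2 * c"
      using * unfolding q_exp n_exp by (simp add: c_def algebra_simps)
    with rr have "t * (2 * (r \<bullet> r)) \<le> t * (t * c)"
      by (simp add: power2_eq_square mult_ac)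
    then show ?thesis using that by (simp only: mult_le_cancel_left_pos)
  qed
  then have "2 * (r \<bullet> r) \<le> 0"
    by (intro tendsto_lowerbound[where f="\<lambda>t. t * c" and F="at_right 0"])
      (auto intro!: tendsto_eq_intros simp: eventually_at_right_less eventually_at_filter)
  then have "r \<bullet> r = 0" using inner_ge_zero[of r] by linarith
  then have "r = 0" by simp
  then show ?thesis using that v by (simp add: r_def)
qed

text \<open>Completeness is the expansion identity rather than a condition on spans, so that it can
  be substituted directly for a vector.\<close>

definition eigenbasis :: "real^'n^'n \<Rightarrow> (real^'n) set \<Rightarrow> (real^'n \<Rightarrow> real) \<Rightarrow> bool" where
  "eigenbasis M B e \<longleftrightarrow> finite B \<and> (\<forall>v\<in>B. \<forall>w\<in>B. v \<bullet> w = (if v = w then 1 else 0)) \<and>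
     (\<forall>v\<in>B. M *v v = e v *\<^sub>R v) \<and> (\<forall>x. x = (\<Sum>v\<in>B. (x \<bullet> v) *\<^sub>R v))"

lemma
  assumes "eigenbasis M B e"
  shows eigenbasis_finite: "finite B"
    and eigenbasis_orthonormal: "\<And>v w. v \<in> B \<Longrightarrow> w \<in> B \<Longrightarrow> v \<bullet> w = (if v = w then 1 else 0)"
    and eigenbasis_eigenvector: "\<And>v. v \<in> B \<Longrightarrow> M *v v = e v *\<^sub>R v"
    and eigenbasis_expansion: "\<And>x. x = (\<Sum>v\<in>B. (x \<bullet> v) *\<^sub>R v)"
  using assms unfolding eigenbasis_def by blast+

text \<open>Choose an orthonormal set of eigenvectors of maximal cardinality. Its orthogonal
  complement is invariant under \<open>M\<close>, so a nonzero vector there would produce a further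
  eigenvector and contradict maximality.\<close>

lemma symmetric_eigenbasis:
  fixes M :: "real^'n^'n"
  assumes sym: "transpose M = M"
  shows "\<exists>B e. eigenbasis M B e"
proof -
  define P where "P B \<longleftrightarrow> finite B \<and> (\<forall>v\<in>B. \<forall>w\<in>B. v \<bullet> w = (if v = w then 1 else 0))
    \<and> (\<forall>v\<in>B. \<exists>l. M *v v = l *\<^sub>R v)" for B
  have "card B < Suc (DIM(real^'n))" if "P B" for B
  proof -
    have "pairwise orthogonal B" "0 \<notin> B"
      using that unfolding P_def pairwise_def orthogonal_def by (metis, metis inner_zero_left zero_neq_one)
    then show ?thesis
      using independent_bound[OF pairwise_orthogonal_independent] le_imp_less_Suc by blast
  qed
  moreover have "P {}" by (simp add: P_def)
  ultimately obtain B where PB: "P B" and Bmax: "\<And>C. P C \<Longrightarrow> card C \<le> card B"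
    using Lattices_Big.ex_has_greatest_nat[of P "{}" card] by blast
  define V where "V = {x. \<forall>v\<in>B. x \<bullet> v = 0}"
  have subV: "subspace V"
    by (auto simp: V_def subspace_def inner_add_left)
  have invV: "M *v x \<in> V" if "x \<in> V" for x
  proof -
    have "(M *v x) \<bullet> v = 0" if v: "v \<in> B" for v
    proof -
      obtain l where "M *v v = l *\<^sub>R v" using PB v unfolding P_def by blast
      then show ?thesis using \<open>x \<in> V\<close> v
        by (simp add: symmetric_inner[OF sym] V_def)
    qed
    then show ?thesis by (simp add: V_def)
  qed
  have V0: "w = 0" if w: "w \<in> V" for w
  proof (rule ccontr)
    assume "w \<noteq> 0"
    then obtain v l where v: "v \<in> V" "norm v = 1" "M *v v = l *\<^sub>R v"
      using symmetric_eigenvector_in_subspace[OF sym subV invV w] by blast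
    have vv: "v \<bullet> v = 1" using v by (simp add: dot_square_norm)
    have orth: "v \<bullet> u = 0" "u \<bullet> v = 0" if "u \<in> B" for u
      using v that by (auto simp: V_def inner_commute)
    have "v \<notin> B" using orth vv by fastforce
    moreover have "P (insert v B)"
      using PB v vv orth \<open>v \<notin> B\<close> unfolding P_def by auto
    ultimately show False using Bmax[of "insert v B"] PB by (simp add: P_def)
  qed
  have "x = (\<Sum>v\<in>B. (x \<bullet> v) *\<^sub>R v)" for x
  proof -
    have "(\<Sum>v\<in>B. (x \<bullet> v) *\<^sub>R v) \<bullet> w = x \<bullet> w" if "w \<in> B" for w
    proof -
      have "(\<Sum>v\<in>B. (x \<bullet> v) *\<^sub>R v) \<bullet> w = (\<Sum>v\<in>B. if v = w then x \<bullet> w else 0)"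
        unfolding inner_sum_left using PB that by (intro sum.cong) (auto simp: P_def)
      then show ?thesis using PB that by (simp add: P_def)
    qed
    then have "x - (\<Sum>v\<in>B. (x \<bullet> v) *\<^sub>R v) \<in> V"
      by (simp add: V_def inner_diff_left)
    then show ?thesis using V0 by fastforce
  qed
  moreover obtain e where "\<forall>v\<in>B. M *v v = e v *\<^sub>R v"
    using PB unfolding P_def by metis
  ultimately show ?thesis
    using PB unfolding P_def eigenbasis_def by blast
qed

text \<open>Functional calculus: with suitable weights \<phi> on an eigenbasis this is the matrix
  itself, its square root or its pseudoinverse.\<close>

definition spectral :: "(real^'n) set \<Rightarrow> (real^'n \<Rightarrow> real) \<Rightarrow> real^'n^'n" where
  "spectral B \<phi> = matrix (\<lambda>x. \<Sum>v\<in>B. (\<phi> v * (x \<bullet> v)) *\<^sub>R v)"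

lemma spectral_mult_vec: "spectral B \<phi> *v x = (\<Sum>v\<in>B. (\<phi> v * (x \<bullet> v)) *\<^sub>R v)"
proof -
  have "linear (\<lambda>x. \<Sum>v\<in>B. (\<phi> v * (x \<bullet> v)) *\<^sub>R v)"
    by (intro linearI) (simp_all add: inner_add_left distrib_left scaleR_add_left sum.distrib
        scaleR_right.sum mult.left_commute)
  then show ?thesis
    by (simp add: spectral_def matrix_works)
qed

lemma spectral_cong: "(\<And>v. v \<in> B \<Longrightarrow> \<phi> v = \<psi> v) \<Longrightarrow> spectral B \<phi> = spectral B \<psi>"
  by (simp add: matrix_eq spectral_mult_vec)

lemma transpose_spectral: "transpose (spectral B \<phi>) = spectral B \<phi>"
  by (rule symmetric_of_inner)
    (simp add: spectral_mult_vec inner_sum_left inner_sum_right inner_commute mult_ac)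

lemma spectral_quadratic: "x \<bullet> (spectral B \<phi> *v x) = (\<Sum>v\<in>B. \<phi> v * (x \<bullet> v)\<^sup>2)"
  by (simp add: spectral_mult_vec inner_sum_right power2_eq_square mult_ac)

lemma spectral_mult:
  assumes B: "eigenbasis M B e"
  shows "spectral B \<phi> ** spectral B \<psi> = spectral B (\<lambda>v. \<phi> v * \<psi> v)"
proof -
  have coord: "(spectral B \<psi> *v x) \<bullet> v = \<psi> v * (x \<bullet> v)" if "v \<in> B" for x v
  proof -
    have "(spectral B \<psi> *v x) \<bullet> v = (\<Sum>w\<in>B. if w = v then \<psi> v * (x \<bullet> v) else 0)"
      unfolding spectral_mult_vec inner_sum_left using eigenbasis_orthonormal[OF B] that by (intro sum.cong) auto
    then show ?thesis using eigenbasis_finite[OF B] that by simp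
  qed
  have "spectral B \<phi> *v (spectral B \<psi> *v x) = spectral B (\<lambda>v. \<phi> v * \<psi> v) *v x" for x
    unfolding spectral_mult_vec[of B \<phi>] spectral_mult_vec[of B "\<lambda>v. \<phi> v * \<psi> v"]
    by (intro sum.cong) (simp_all add: coord)
  then show ?thesis by (simp add: matrix_eq matrix_vector_mul_assoc[symmetric])
qed

lemma eigenbasis_spectral:
  fixes M :: "real^'n^'n"
  assumes B: "eigenbasis M B e"
  shows "M = spectral B e"
proof -
  have "M *v x = spectral B e *v x" for x
  proof -
    have "M *v x = M *v (\<Sum>v\<in>B. (x \<bullet> v) *\<^sub>R v)" using eigenbasis_expansion[OF B, of x] by simp
    also have "\<dots> = (\<Sum>v\<in>B. M *v ((x \<bullet> v) *\<^sub>R v))"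
      by (rule linear_sum[OF matrix_vector_mul_linear])
    also have "\<dots> = spectral B e *v x"
      unfolding spectral_mult_vec
      by (intro sum.cong)
        (simp_all add: matrix_vector_mult_scaleR eigenbasis_eigenvector[OF B] mult.commute)
    finally show ?thesis .
  qed
  then show ?thesis by (simp add: matrix_eq)
qed

section \<open>Square roots of positive semidefinite matrices\<close>

lemma psd_sym: "psd M \<Longrightarrow> transpose M = M"
  and psd_nonneg: "psd M \<Longrightarrow> 0 \<le> x \<bullet> (M *v x)"
  by (simp_all add: psd_def)

lemma psd_eigval_nonneg:
  assumes "psd M" "M *v v = l *\<^sub>R v" "v \<noteq> 0"
  shows "l \<ge> 0"
proof -
  have "0 \<le> l * (v \<bullet> v)" using psd_nonneg[OF assms(1), of v] assms(2) by simp
  moreover have "v \<bullet> v > 0" using assms(3) by simp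
  ultimately show ?thesis by (simp add: zero_le_mult_iff)
qed

text \<open>On an eigenvector \<open>v\<close> of \<open>S\<close> with eigenvalue
  \<open>e v\<close>, the vector \<open>w = T *v v - e v *\<^sub>R v\<close> satisfies
  \<open>T *v w = - e v *\<^sub>R w\<close>. A positive \<open>e v\<close> would make this a
  negative eigenvalue of \<open>T\<close> unless \<open>w = 0\<close>. Hence \<open>T\<close> agrees
  with \<open>S\<close> on an eigenbasis.\<close>

lemma psd_sqrt_unique:
  fixes S T :: "real^'n^'n"
  assumes S: "psd S" and T: "psd T" and eq: "S ** S = T ** T"
  shows "S = T"
proof -
  obtain B e where B: "eigenbasis S B e"
    using symmetric_eigenbasis[OF psd_sym[OF S]] by blast
  have T_eig: "T *v v = e v *\<^sub>R v" if v: "v \<in> B" for v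
  proof -
    have "v \<noteq> 0" using eigenbasis_orthonormal[OF B v v] by auto
    then have e: "e v \<ge> 0" using psd_eigval_nonneg[OF S eigenbasis_eigenvector[OF B v]] by simp
    have TT: "T *v (T *v v) = (e v * e v) *\<^sub>R v"
      using arg_cong[OF eq, of "\<lambda>M. M *v v"] eigenbasis_eigenvector[OF B v]
      by (simp add: matrix_vector_mul_assoc[symmetric] matrix_vector_mult_scaleR)
    show ?thesis
    proof (cases "e v = 0")
      \<comment> \<open>Here \<open>- e v\<close> is not negative, so the norm of
        \<open>T *v v\<close> is computed from \<open>T *v (T *v v) = 0\<close> instead.\<close>
      case True
      then have "(T *v v) \<bullet> (T *v v) = 0"
        using TT symmetric_inner[OF psd_sym[OF T], of v "T *v v"] by simp
      with True show ?thesis by simp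
    next
      case False
      define w where "w = T *v v - e v *\<^sub>R v"
      have "T *v w = - e v *\<^sub>R w"
        using TT by (simp add: w_def matrix_vector_mult_diff_distrib matrix_vector_mult_scaleR
            scaleR_diff_right)
      then have "w = 0"
        using psd_eigval_nonneg[OF T, of w "- e v"] e False by fastforce
      then show ?thesis by (simp add: w_def)
    qed
  qed
  have "S *v x = T *v x" for x
  proof -
    have "S *v (\<Sum>v\<in>B. (x \<bullet> v) *\<^sub>R v) = T *v (\<Sum>v\<in>B. (x \<bullet> v) *\<^sub>R v)"
      unfolding linear_sum[OF matrix_vector_mul_linear]
      by (intro sum.cong) (simp_all add: matrix_vector_mult_scaleR eigenbasis_eigenvector[OF B] T_eig)
    then show ?thesis using eigenbasis_expansion[OF B, of x] by simp
  qed
  then show ?thesis by (simp add: matrix_eq)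
qed

text \<open>Roots of the eigenvalues give existence; together with uniqueness the definite
  description in \<open>psd_sqrt\<close> denotes.\<close>

lemma
  assumes "psd M"
  shows psd_psd_sqrt: "psd (psd_sqrt M)" and psd_sqrt_square: "psd_sqrt M ** psd_sqrt M = M"
proof -
  obtain B e where B: "eigenbasis M B e"
    using symmetric_eigenbasis[OF psd_sym[OF assms]] by blast
  have e: "e v \<ge> 0" if "v \<in> B" for v
    using psd_eigval_nonneg[OF assms eigenbasis_eigenvector[OF B that]] eigenbasis_orthonormal[OF B that that] by fastforce
  have "psd (spectral B (\<lambda>v. sqrt (e v)))"
    unfolding psd_def spectral_quadratic using e
    by (auto intro!: sum_nonneg mult_nonneg_nonneg simp: transpose_spectral)
  moreover have "spectral B (\<lambda>v. sqrt (e v)) ** spectral B (\<lambda>v. sqrt (e v)) = M"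
    unfolding spectral_mult[OF B] eigenbasis_spectral[OF B] using e
    by (intro spectral_cong) simp
  ultimately have "\<exists>!S. psd S \<and> S ** S = M"
    using psd_sqrt_unique by metis
  then have "psd (psd_sqrt M) \<and> psd_sqrt M ** psd_sqrt M = M"
    unfolding psd_sqrt_def by (rule theI')
  then show "psd (psd_sqrt M)" and "psd_sqrt M ** psd_sqrt M = M" by auto
qed

section \<open>The Moore-Penrose pseudoinverse\<close>

lemma pinv_unique:
  fixes M :: "real^'n^'m" and B C :: "real^'m^'n"
  assumes B: "M ** B ** M = M" "B ** M ** B = B"
      "transpose (M ** B) = M ** B" "transpose (B ** M) = B ** M"
    and C: "M ** C ** M = M" "C ** M ** C = C"
      "transpose (M ** C) = M ** C" "transpose (C ** M) = C ** M"
  shows "B = C"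
proof -
  \<comment> \<open>Both \<open>M ** B\<close> and \<open>M ** C\<close> are symmetric and act as
    the identity on the range of \<open>M\<close>, so transposing their product exchanges
    them.\<close>
  have "M ** B = (M ** C) ** (M ** B)"
    using C(1) by (simp add: matrix_mul_assoc)
  also have "\<dots> = transpose ((M ** B) ** (M ** C))"
    by (simp only: matrix_transpose_mul[of "M ** B" "M ** C"] B(3) C(3))
  also have "\<dots> = M ** C" using B(1) C(3) by (simp add: matrix_mul_assoc)
  finally have MB: "M ** B = M ** C" .
  have "B ** M = (B ** M) ** (C ** M)"
    using C(1) by (simp add: matrix_mul_assoc[symmetric])
  also have "\<dots> = transpose ((C ** M) ** (B ** M))"
    by (simp only: matrix_transpose_mul[of "C ** M" "B ** M"] B(4) C(4))
  also have "\<dots> = C ** M" using B(1) C(4) by (simp add: matrix_mul_assoc[symmetric])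
  finally have BM: "B ** M = C ** M" .
  have "B = (C ** M) ** B" using B(2) BM by simp
  also have "\<dots> = C ** M ** C" using MB by (simp add: matrix_mul_assoc[symmetric])
  finally show ?thesis using C(2) by simp
qed

text \<open>Reciprocals of the eigenvalues solve the Penrose equations. The convention
  \<open>inverse 0 = 0\<close> supplies the correct value on the kernel.\<close>

lemma
  fixes M :: "real^'n^'n"
  assumes "transpose M = M"
  shows mult_pinv_mult: "M ** pinv M ** M = M"
    and transpose_mult_pinv: "transpose (M ** pinv M) = M ** pinv M"
proof -
  obtain B e where B: "eigenbasis M B e"
    using symmetric_eigenbasis[OF assms] by blast
  let ?Q = "\<lambda>C. M ** C ** M = M \<and> C ** M ** C = C \<and>
                    transpose (M ** C) = M ** C \<and> transpose (C ** M) = C ** M"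
  have "?Q (spectral B (\<lambda>v. inverse (e v)))"
    unfolding eigenbasis_spectral[OF B] spectral_mult[OF B] transpose_spectral
    by (intro conjI arg_cong[where f="spectral B"] ext) (auto simp: field_simps)
  then have "\<exists>!C. ?Q C" using pinv_unique[of M] by (intro ex_ex1I) metis+
  then have "?Q (pinv M)" unfolding pinv_def by (rule theI')
  then show "M ** pinv M ** M = M" and "transpose (M ** pinv M) = M ** pinv M" by auto
qed

text \<open>Every eigenvalue occurs among the finitely many values \<open>e v\<close>, so
  \<open>Max\<close> is taken over a finite set and bounds each coefficient of the diagonalised
  form.\<close>

lemma quadratic_le_lambda_max:
  fixes M :: "real^'n^'n"
  assumes sym: "transpose M = M"
  shows "x \<bullet> (M *v x) \<le> lambda_max M * (x \<bullet> x)"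
proof -
  obtain B e where B: "eigenbasis M B e"
    using symmetric_eigenbasis[OF sym] by blast
  have "l \<in> e ` B" if l: "l \<in> eigvals M" for l
  proof -
    obtain v where v: "v \<noteq> 0" "M *v v = l *\<^sub>R v" using l by (auto simp: eigvals_def)
    have "\<exists>w\<in>B. v \<bullet> w \<noteq> 0"
      using v(1) eigenbasis_expansion[OF B, of v] by (metis (no_types, lifting) scaleR_eq_0_iff sum.neutral)
    then obtain w where w: "w \<in> B" "v \<bullet> w \<noteq> 0" by blast
    \<comment> \<open>Eigenvectors of a symmetric matrix that are not orthogonal share their
      eigenvalue.\<close>
    have "l * (v \<bullet> w) = e w * (v \<bullet> w)"
      using symmetric_inner[OF sym, of v w] v(2) eigenbasis_eigenvector[OF B w(1)] by simp
    then show ?thesis using w by auto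
  qed
  then have fin: "finite (eigvals M)" using eigenbasis_finite[OF B] by (meson finite_imageI finite_subset subsetI)
  have "e v \<le> lambda_max M" if "v \<in> B" for v
    unfolding lambda_max_def using eigenbasis_orthonormal[OF B that that] eigenbasis_eigenvector[OF B that]
    by (intro Max_ge[OF fin]) (auto simp: eigvals_def intro!: exI[of _ v])
  then have "(\<Sum>v\<in>B. e v * (x \<bullet> v)\<^sup>2) \<le> (\<Sum>v\<in>B. lambda_max M * (x \<bullet> v)\<^sup>2)"
    by (intro sum_mono mult_right_mono) simp_all
  then have "x \<bullet> (M *v x) \<le> (\<Sum>v\<in>B. lambda_max M * (x \<bullet> v)\<^sup>2)"
    using spectral_quadratic[of x B e] eigenbasis_spectral[OF B] by simp
  also have "\<dots> = lambda_max M * (x \<bullet> (\<Sum>v\<in>B. (x \<bullet> v) *\<^sub>R v))"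
    by (simp add: inner_sum_right sum_distrib_left power2_eq_square)
  also have "(\<Sum>v\<in>B. (x \<bullet> v) *\<^sub>R v) = x" using eigenbasis_expansion[OF B, of x] by simp
  finally show ?thesis .
qed

section \<open>Seminorms weighted by a matrix or its pseudoinverse\<close>

lemma psd_sqrt_mult_vec:
  assumes "psd M" shows "psd_sqrt M *v (psd_sqrt M *v x) = M *v x"
  using psd_sqrt_square[OF assms] by (simp add: matrix_vector_mul_assoc)

lemma psd_sqrt_kernel:
  assumes "psd M" shows "psd_sqrt M *v x = 0 \<longleftrightarrow> M *v x = 0"
proof
  assume "M *v x = 0"
  then have "(psd_sqrt M *v x) \<bullet> (psd_sqrt M *v x) = 0"
    using symmetric_inner[OF psd_sym[OF psd_psd_sqrt[OF assms]], of x "psd_sqrt M *v x"]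
      psd_sqrt_mult_vec[OF assms] by simp
  then show "psd_sqrt M *v x = 0" by simp
next
  assume "psd_sqrt M *v x = 0"
  then show "M *v x = 0" using psd_sqrt_mult_vec[OF assms, of x] by simp
qed

text \<open>Reduces the weighted seminorm to a Euclidean norm, from which the triangle and
  Cauchy-Schwarz inequalities are inherited.\<close>

lemma wnorm_eq_norm_sqrt:
  assumes "psd M" shows "wnorm M x = norm (psd_sqrt M *v x)"
  using symmetric_inner[OF psd_sym[OF psd_psd_sqrt[OF assms]], of x "psd_sqrt M *v x"]
  by (simp add: wnorm_def norm_eq_sqrt_inner psd_sqrt_mult_vec[OF assms])

lemma wnorm_power2:
  assumes "psd M" shows "(wnorm M x)\<^sup>2 = x \<bullet> (M *v x)"
  using psd_nonneg[OF assms] by (simp add: wnorm_def)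

lemma wnorm_add_le: "psd M \<Longrightarrow> wnorm M (x + y) \<le> wnorm M x + wnorm M y"
  and wnorm_diff_le: "psd M \<Longrightarrow> wnorm M (x - y) \<le> wnorm M x + wnorm M y"
  by (simp_all add: wnorm_eq_norm_sqrt matrix_vector_right_distrib matrix_vector_mult_diff_distrib
      norm_triangle_ineq norm_triangle_ineq4)

lemma wnorm_Cauchy_Schwarz:
  assumes "psd M" shows "x \<bullet> (M *v y) \<le> wnorm M x * wnorm M y"
proof -
  have "x \<bullet> (M *v y) = (psd_sqrt M *v x) \<bullet> (psd_sqrt M *v y)"
    by (simp add: symmetric_inner[OF psd_sym[OF psd_psd_sqrt[OF assms]]] psd_sqrt_mult_vec[OF assms])
  then show ?thesis by (simp add: wnorm_eq_norm_sqrt[OF assms] norm_cauchy_schwarz)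
qed

text \<open>Transposing \<open>M ** pinv M ** M = M\<close> moves the symmetric factor
  \<open>M ** pinv M\<close> to the other side.\<close>

lemma mult_mult_pinv:
  fixes M :: "real^'n^'n"
  assumes "transpose M = M"
  shows "M *v (M *v (pinv M *v x)) = M *v x"
proof -
  have "M ** (M ** pinv M) = transpose ((M ** pinv M) ** M)"
    by (simp only: matrix_transpose_mul[of "M ** pinv M" M] transpose_mult_pinv[OF assms] assms)
  also have "\<dots> = M" by (simp add: mult_pinv_mult[OF assms] assms)
  finally show ?thesis by (metis matrix_vector_mul_assoc)
qed

text \<open>\<open>M ** pinv M\<close> is the orthogonal projection onto the range of
  \<open>M\<close>. The matrix \<open>psd_sqrt M\<close> has the same kernel, hence by symmetry the
  same range, which the projection fixes.\<close>

lemma mult_pinv_psd_sqrt: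
  assumes "psd M"
  shows "M *v (pinv M *v (psd_sqrt M *v w)) = psd_sqrt M *v w"
proof -
  let ?S = "psd_sqrt M"
  note sym = psd_sym[OF assms]
  have "(M *v (pinv M *v (?S *v w)) - ?S *v w) \<bullet> x = 0" for x
  proof -
    have "M *v (M *v (pinv M *v x) - x) = 0"
      by (simp add: matrix_vector_mult_diff_distrib mult_mult_pinv[OF sym])
    then have *: "?S *v (M *v (pinv M *v x) - x) = 0"
      by (simp only: psd_sqrt_kernel[OF assms])
    have "(M *v (pinv M *v (?S *v w))) \<bullet> x = (?S *v w) \<bullet> (M *v (pinv M *v x))"
      using symmetric_inner[OF transpose_mult_pinv[OF sym], of "?S *v w" x]
      by (simp only: matrix_vector_mul_assoc[symmetric])
    then have "(M *v (pinv M *v (?S *v w)) - ?S *v w) \<bullet> x = (?S *v w) \<bullet> (M *v (pinv M *v x) - x)"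
      by (simp only: inner_diff_left inner_diff_right)
    also have "\<dots> = w \<bullet> (?S *v (M *v (pinv M *v x) - x))"
      by (rule symmetric_inner[OF psd_sym[OF psd_psd_sqrt[OF assms]]])
    finally show ?thesis by (simp add: *)
  qed
  then show ?thesis by (metis inner_eq_zero_iff right_minus_eq)
qed

text \<open>A vector in the range of \<open>psd_sqrt M\<close> has the form \<open>M *v d\<close>
  with \<open>d\<close> its image under \<open>pinv M\<close>, so the form of \<open>pinv M\<close>
  there equals \<open>d \<bullet> (M *v d)\<close> and is nonnegative.\<close>

lemma wnorm_pinv_power2:
  assumes "psd M"
  shows "(wnorm (pinv M) (psd_sqrt M *v w))\<^sup>2
    = (psd_sqrt M *v w) \<bullet> (pinv M *v (psd_sqrt M *v w))"
proof -
  define d where "d = pinv M *v (psd_sqrt M *v w)"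
  have "M *v d = psd_sqrt M *v w" unfolding d_def by (rule mult_pinv_psd_sqrt[OF assms])
  then have "0 \<le> (psd_sqrt M *v w) \<bullet> d"
    using psd_nonneg[OF assms, of d] by (simp add: inner_commute)
  then show ?thesis by (simp add: wnorm_def d_def)
qed

text \<open>Describes the update of \<open>v\<close> in the pseudoinverse norm: the weight cancels
  against \<open>M\<close>, so the cross term is a plain inner product with
  \<open>y\<close>.\<close>

lemma wnorm_pinv_step:
  assumes "psd M"
  shows "(wnorm (pinv M) (psd_sqrt M *v w + \<rho> *\<^sub>R (M *v y)))\<^sup>2
    = (wnorm (pinv M) (psd_sqrt M *v w))\<^sup>2 + 2 * \<rho> * ((psd_sqrt M *v w) \<bullet> y) + \<rho>\<^sup>2 * (y \<bullet> (M *v y))"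
proof -
  let ?S = "psd_sqrt M"
  note sym = psd_sym[OF assms]
  define e where "e = ?S *v w"
  define d where "d = pinv M *v e"
  have Md: "M *v d = e" unfolding d_def e_def by (rule mult_pinv_psd_sqrt[OF assms])
  have MMM: "M *v (pinv M *v (M *v y)) = M *v y"
    by (metis matrix_vector_mul_assoc mult_pinv_mult[OF sym])
  have e': "e + \<rho> *\<^sub>R (M *v y) = ?S *v (w + \<rho> *\<^sub>R (?S *v y))"
    by (simp add: e_def matrix_vector_right_distrib matrix_vector_mult_scaleR psd_sqrt_mult_vec[OF assms])
  have p1: "e \<bullet> (pinv M *v (M *v y)) = e \<bullet> y"
  proof -
    have "e \<bullet> (pinv M *v (M *v y)) = d \<bullet> (M *v (pinv M *v (M *v y)))"
      unfolding Md[symmetric] by (rule symmetric_inner[OF sym])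
    also have "\<dots> = e \<bullet> y"
      unfolding MMM Md[symmetric] by (rule symmetric_inner[OF sym, symmetric])
    finally show ?thesis .
  qed
  have p2: "(M *v y) \<bullet> d = e \<bullet> y"
    using symmetric_inner[OF sym, of y d] Md by (simp add: inner_commute)
  have p3: "(M *v y) \<bullet> (pinv M *v (M *v y)) = y \<bullet> (M *v y)"
    by (simp add: symmetric_inner[OF sym] MMM)
  have "(wnorm (pinv M) (e + \<rho> *\<^sub>R (M *v y)))\<^sup>2
      = (e + \<rho> *\<^sub>R (M *v y)) \<bullet> (pinv M *v (e + \<rho> *\<^sub>R (M *v y)))"
    unfolding e' by (rule wnorm_pinv_power2[OF assms])
  also have "pinv M *v (e + \<rho> *\<^sub>R (M *v y)) = d + \<rho> *\<^sub>R (pinv M *v (M *v y))"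
    by (simp add: d_def matrix_vector_right_distrib matrix_vector_mult_scaleR)
  also have "(e + \<rho> *\<^sub>R (M *v y)) \<bullet> \<dots> = e \<bullet> d + 2 * \<rho> * (e \<bullet> y) + \<rho>\<^sup>2 * (y \<bullet> (M *v y))"
    by (simp add: inner_add_left inner_add_right p1 p2 p3 algebra_simps power2_eq_square)
  also have "e \<bullet> d = (wnorm (pinv M) e)\<^sup>2"
    unfolding d_def e_def by (rule wnorm_pinv_power2[OF assms, symmetric])
  finally show ?thesis by (simp add: e_def)
qed

section \<open>Kronecker products and consensus vectors\<close>

text \<open>A stacked vector is read as a matrix with one row per agent; the Kronecker product with
  an identity acts on each column separately.\<close>

definition column :: "'c \<Rightarrow> real^('n::finite \<times> 'c::finite) \<Rightarrow> real^'n" where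
  "column c x = (\<chi> i. x $ (i, c))"

text \<open>The Kronecker product of the all-ones vector with \<eta>: every agent holds the same
  copy.\<close>

definition consensus :: "real^'c::finite \<Rightarrow> real^('n::finite \<times> 'c)" where
  "consensus \<eta> = (\<chi> r. \<eta> $ snd r)"

lemma kron_mat_one_nth:
  fixes P :: "real^'n^'n" and x :: "real^('n \<times> 'c::finite)"
  shows "(kron P (mat 1) *v x) $ (i, c) = (P *v column c x) $ i"
proof -
  have "(kron P (mat 1) *v x) $ (i, c) =
      (\<Sum>s\<in>UNIV \<times> UNIV. P $ i $ fst s * (if c = snd s then 1 else 0) * x $ s)"
    by (simp add: matrix_vector_mult_def kron_def mat_def)
  also have "\<dots> = (\<Sum>j\<in>UNIV. \<Sum>e\<in>UNIV. if c = e then P $ i $ j * x $ (j, c) else 0)"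
    unfolding sum.cartesian_product by (auto intro!: sum.cong)
  finally show ?thesis by (simp add: matrix_vector_mult_def column_def)
qed

lemma kron_mat_one_inner:
  fixes P :: "real^'n^'n" and x y :: "real^('n \<times> 'c::finite)"
  shows "x \<bullet> (kron P (mat 1) *v y) = (\<Sum>c\<in>UNIV. column c x \<bullet> (P *v column c y))"
proof -
  have "x \<bullet> (kron P (mat 1) *v y) =
      (\<Sum>(i, c)\<in>UNIV \<times> UNIV. x $ (i, c) * (P *v column c y) $ i)"
    unfolding inner_vec_def by (auto intro!: sum.cong simp: kron_mat_one_nth)
  also have "\<dots> = (\<Sum>c\<in>UNIV. \<Sum>i\<in>UNIV. x $ (i, c) * (P *v column c y) $ i)"
    by (subst sum.cartesian_product[symmetric]) (rule sum.swap)
  finally show ?thesis by (simp add: inner_vec_def column_def)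
qed

lemma kron_add_left: "kron (P + Q) R = kron P R + kron Q R"
  and kron_diff_left: "kron (P - Q) R = kron P R - kron Q R"
  and kron_scaleR_left: "kron (a *\<^sub>R P) R = a *\<^sub>R kron P R"
  by (simp_all add: kron_def vec_eq_iff algebra_simps)

lemma transpose_kron: "transpose (kron P Q) = kron (transpose P) (transpose Q)"
  by (simp add: kron_def transpose_def vec_eq_iff)

lemma psd_kron_mat_one:
  assumes "psd P" shows "psd (kron P (mat 1))"
  using assms unfolding psd_def transpose_kron
  by (auto simp: kron_mat_one_inner transpose_mat intro!: sum_nonneg)

lemma column_consensus: "column c (consensus \<eta>) = (\<eta> $ c) *\<^sub>R vec 1"
  by (simp add: column_def consensus_def vec_eq_iff)

lemma kron_mat_one_consensus:
  fixes P :: "real^'n^'n"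
  assumes "P *v vec 1 = 0"
  shows "kron P (mat 1) *v consensus \<eta> = 0"
proof -
  have "(kron P (mat 1) *v consensus \<eta>) $ (i, c) = 0" for i c
    unfolding kron_mat_one_nth column_consensus matrix_vector_mult_scaleR assms by simp
  then show ?thesis by (simp add: vec_eq_iff)
qed

lemma kron_mat_one_kernel:
  fixes P :: "real^'n^'n"
  assumes "null_space P \<subseteq> span {vec 1}" and x: "kron P (mat 1) *v x = 0"
  obtains \<zeta> where "x = consensus \<zeta>"
proof -
  have "\<exists>a. column c x = a *\<^sub>R vec 1" for c
  proof -
    have "P *v column c x = 0" using x by (simp add: vec_eq_iff flip: kron_mat_one_nth)
    then show ?thesis using assms(1) by (auto simp: null_space_def span_singleton)
  qed
  then obtain a where a: "\<And>c. column c x = a c *\<^sub>R vec 1" by metis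
  have "x $ (i, c) = a c" for i c
    using arg_cong[OF a[of c], of "\<lambda>v. v $ i"] by (simp add: column_def)
  then have "x = consensus (\<chi> c. a c)" by (simp add: vec_eq_iff consensus_def)
  then show ?thesis using that by blast
qed

lemma consensus_inner: "consensus \<eta> \<bullet> x = (\<Sum>c\<in>UNIV. \<eta> $ c * (\<Sum>i\<in>UNIV. x $ (i, c)))"
  for x :: "real^('n::finite \<times> 'c::finite)"
proof -
  have "consensus \<eta> \<bullet> x = (\<Sum>(i, c)\<in>UNIV \<times> UNIV. \<eta> $ c * x $ (i, c))"
    unfolding inner_vec_def consensus_def by (auto intro!: sum.cong)
  also have "\<dots> = (\<Sum>c\<in>UNIV. \<Sum>i\<in>UNIV. \<eta> $ c * x $ (i, c))"
    by (subst sum.cartesian_product[symmetric]) (rule sum.swap)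
  finally show ?thesis by (simp add: sum_distrib_left)
qed

text \<open>Source of \<open>C1\<close>: every column is a multiple of the all-ones vector, whose
  squared norm is the number of agents.\<close>

lemma consensus_quadratic_le:
  fixes P :: "real^'n^'n" and \<eta> :: "real^'c::finite"
  assumes "transpose P = P"
  shows "consensus \<eta> \<bullet> (kron P (mat 1) *v consensus \<eta>) \<le> real CARD('n) * lambda_max P * (\<eta> \<bullet> \<eta>)"
proof -
  have "consensus \<eta> \<bullet> (kron P (mat 1) *v consensus \<eta>) = (vec 1 \<bullet> (P *v vec 1)) * (\<eta> \<bullet> \<eta>)"
    by (simp add: kron_mat_one_inner column_consensus matrix_vector_mult_scaleR inner_vec_def[of \<eta>]
        sum_distrib_left mult_ac)
  also have "vec 1 \<bullet> (P *v vec 1) \<le> lambda_max P * (vec 1 \<bullet> (vec 1 :: real^'n))"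
    by (rule quadratic_le_lambda_max[OF assms])
  also have "vec 1 \<bullet> (vec 1 :: real^'n) = real CARD('n)"
    by (simp add: inner_vec_def)
  finally show ?thesis by (simp add: mult_right_mono mult_ac)
qed

section \<open>The cone and the proximal step\<close>

text \<open>The cone is a product of half-lines and lines, so its projection clips coordinate by
  coordinate.\<close>

definition proj_K :: "real^('n::finite \<times> ('m::finite + 'p::finite)) \<Rightarrow> real^('n \<times> ('m + 'p))" where
  "proj_K q = (\<chi> r. case snd r of Inl j \<Rightarrow> max 0 (q $ r) | Inr l \<Rightarrow> q $ r)"

lemma proj_K_Inl [simp]: "proj_K q $ (i, Inl j) = max 0 (q $ (i, Inl j))"
  and proj_K_Inr [simp]: "proj_K q $ (i, Inr l) = q $ (i, Inr l)"
  by (simp_all add: proj_K_def)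

lemma prod_sum_cases:
  obtains i j where "r = (i, Inl j)" | i l where "r = (i, Inr l)"
  by (metis surj_pair sum.exhaust)

lemma closest_point_cone_K:
  fixes q :: "real^('n::finite \<times> ('m::finite + 'p::finite))"
  shows "closest_point cone_K q = proj_K q"
proof -
  have "convex (cone_K :: (real^('n \<times> ('m + 'p))) set)"
    by (auto simp: cone_K_def convex_def)
  moreover have "closed (cone_K :: (real^('n \<times> ('m + 'p))) set)"
    unfolding cone_K_def by (intro closed_Collect_all closed_Collect_le continuous_intros)
  moreover have "proj_K q \<in> cone_K" by (simp add: cone_K_def)
  moreover have "dist q (proj_K q) \<le> dist q y" if y: "y \<in> cone_K" for y
    unfolding dist_norm
  proof (rule norm_le_componentwise_cart)
    fix r show "norm ((q - proj_K q) $ r) \<le> norm ((q - y) $ r)"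
    proof (cases r rule: prod_sum_cases)
      case (1 i j)
      have "0 \<le> y $ r" using y 1 by (simp add: cone_K_def)
      then show ?thesis using 1 by (simp add: max_def)
    qed simp
  qed
  ultimately show ?thesis by (metis closest_point_unique)
qed

lemma proj_K_in_cone_K: "proj_K q \<in> cone_K"
  by (simp add: cone_K_def)

text \<open>A positive scaling preserves supports, so \<open>yp\<close> vanishes wherever
  \<open>proj_K\<close> clips and \<open>q - proj_K q\<close> is orthogonal to it. This residual is
  nonpositive on inequality coordinates and zero on equality coordinates.\<close>

lemma scaled_proj_K_polar:
  assumes "\<And>r. d r > 0" and "y \<in> cone_K" and "\<And>r. d r * yp $ r = proj_K q $ r"
  shows "(q - proj_K q) \<bullet> (y - yp) \<le> 0" and "(q - proj_K q) \<bullet> y \<le> 0"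
proof -
  have "(q - proj_K q) $ r * y $ r \<le> 0 \<and> (q - proj_K q) $ r * yp $ r = 0" for r
  proof (cases r rule: prod_sum_cases)
    case (1 i j)
    have "yp $ r = 0" if "q $ r \<le> 0"
    proof -
      have "d r * yp $ r = 0" using assms(3)[of r] that 1 by simp
      then show ?thesis using assms(1)[of r] by simp
    qed
    then show ?thesis
      using 1 assms(2) by (auto simp: cone_K_def max_def mult_le_0_iff)
  qed simp
  then have "(q - proj_K q) \<bullet> y \<le> 0" "(q - proj_K q) \<bullet> yp = 0"
    by (auto simp only: inner_vec_def inner_real_def intro!: sum_nonpos sum.neutral)
  then show "(q - proj_K q) \<bullet> y \<le> 0" "(q - proj_K q) \<bullet> (y - yp) \<le> 0"
    by (simp_all add: inner_diff_right)
qed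

text \<open>Exhibiting a two-sided inverse \<open>E\<close> ensures that the choice in
  \<open>matrix_inv\<close> picks an actual inverse.\<close>

lemma matrix_inv_diagonal:
  fixes D :: "real^'n^'n"
  assumes diag: "diagonal_matrix D" and pos: "\<And>i. D $ i $ i \<noteq> 0"
  shows "(matrix_inv D *v x) $ i = x $ i / D $ i $ i"
proof -
  define E :: "real^'n^'n" where "E = (\<chi> i j. if i = j then 1 / D $ i $ i else 0)"
  have Dv: "(D *v x) $ i = D $ i $ i * x $ i" for x i
  proof -
    have "(D *v x) $ i = (\<Sum>j\<in>UNIV. if i = j then D $ i $ i * x $ i else 0)"
      unfolding matrix_vector_mult_def vec_lambda_beta
      using diag by (intro sum.cong) (auto simp: diagonal_matrix_def)
    then show ?thesis by simp
  qed
  have Ev: "(E *v x) $ i = x $ i / D $ i $ i" for x i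
    by (simp add: E_def matrix_vector_mult_def if_distrib if_distribR cong: if_cong)
  have "D *v (E *v x) = x" "E *v (D *v x) = x" for x
    using pos by (simp_all add: vec_eq_iff Dv Ev)
  then have "D ** E = mat 1" "E ** D = mat 1"
    by (simp_all add: matrix_eq matrix_vector_mul_assoc[symmetric])
  then have "D ** matrix_inv D = mat 1"
    unfolding matrix_inv_def by (metis (mono_tags, lifting) someI_ex)
  then have "D *v (matrix_inv D *v x) = x"
    by (simp add: matrix_vector_mul_assoc)
  then have "D $ i $ i * (matrix_inv D *v x) $ i = x $ i"
    by (simp flip: Dv)
  then show ?thesis using pos[of i] by (simp add: field_simps)
qed

lemma nonneg_of_nonneg_add_small:
  fixes a c :: real
  assumes "\<And>t. 0 < t \<Longrightarrow> t \<le> 1 \<Longrightarrow> 0 \<le> a + t * c"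
  shows "0 \<le> a"
proof (rule tendsto_lowerbound)
  show "((\<lambda>t. a + t * c) \<longlongrightarrow> a) (at_right 0)"
    by (auto intro!: tendsto_eq_intros)
  show "eventually (\<lambda>t. 0 \<le> a + t * c) (at_right 0)"
    using eventually_at_right[of 0 "1::real"] assms by (auto intro!: exI[of _ 1])
qed simp

text \<open>A quadratic upper model of the squared positive part. Only an upper bound on
  \<open>s\<close> is assumed, as convexity of a constraint provides.\<close>

lemma max_zero_square_le:
  fixes q s e :: real
  assumes "s \<le> q + e"
  shows "(max 0 s)\<^sup>2 \<le> (max 0 q)\<^sup>2 + 2 * max 0 q * e + e\<^sup>2"
proof -
  have "(max 0 s)\<^sup>2 \<le> (max 0 (q + e))\<^sup>2"
    using assms by (intro power_mono) auto
  also have "\<dots> \<le> (max 0 q + e)\<^sup>2"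
  proof (cases "q + e \<le> 0")
    case False
    then have "0 \<le> q + e" "q + e \<le> max 0 q + e" by auto
    then show ?thesis using power_mono by (metis max.absorb2)
  qed auto
  finally show ?thesis by (simp add: power2_sum)
qed

text \<open>Compare \<open>xp\<close> with the point \<open>ut\<close> at fraction \<open>t\<close>
  towards \<open>u\<close>. By the choice of \<open>y\<close>, the penalty has first-order term
  \<open>t * (y \<bullet> (G u - G xp))\<close>; all remaining errors are of order
  \<open>t^2\<close>. Divide by \<open>t\<close> and let it tend to zero.\<close>

lemma prox_step_optimality:
  fixes F :: "real^'d \<Rightarrow> real" and G :: "real^'d \<Rightarrow> real^('n::finite \<times> ('m::finite + 'p::finite))"
  assumes F: "convex_on C F"
    and G_Inl: "\<And>i j. convex_on C (\<lambda>u. G u $ (i, Inl j))"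
    and G_Inr: "\<And>i l s t u v. u \<in> C \<Longrightarrow> v \<in> C \<Longrightarrow> 0 \<le> s \<Longrightarrow> 0 \<le> t \<Longrightarrow> s + t = 1 \<Longrightarrow>
      G (s *\<^sub>R u + t *\<^sub>R v) $ (i, Inr l) = s * G u $ (i, Inr l) + t * G v $ (i, Inr l)"
    and d: "\<And>r. d r > 0"
    and min: "is_arg_min (\<lambda>u. F u + 1/2 * (\<Sum>r\<in>UNIV. (proj_K (w + G u) $ r)\<^sup>2 / d r)
                + \<alpha>/2 * (norm (u - x0))\<^sup>2) (\<lambda>u. u \<in> C) xp"
    and u: "u \<in> C" and y: "\<And>r. d r * y $ r = proj_K (w + G xp) $ r"
  shows "0 \<le> F u - F xp + y \<bullet> (G u - G xp) + \<alpha> * ((xp - x0) \<bullet> (u - xp))"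
proof -
  have xp: "xp \<in> C" using min by (simp add: is_arg_min_def)
  define q where "q = w + G xp"
  define \<Delta> where "\<Delta> = G u - G xp"
  define c where "c = 1/2 * (\<Sum>r\<in>UNIV. (\<Delta> $ r)\<^sup>2 / d r) + \<alpha>/2 * (norm (u - xp))\<^sup>2"
  have "0 \<le> (F u - F xp + y \<bullet> \<Delta> + \<alpha> * ((xp - x0) \<bullet> (u - xp))) + t * c"
    if t: "0 < t" "t \<le> 1" for t
  proof -
    define ut where "ut = (1 - t) *\<^sub>R xp + t *\<^sub>R u"
    have "ut \<in> C" unfolding ut_def using t xp u convex_on_imp_convex[OF F]
      by (simp add: convex_alt)
    then have opt: "F xp + 1/2 * (\<Sum>r\<in>UNIV. (proj_K q $ r)\<^sup>2 / d r) + \<alpha>/2 * (norm (xp - x0))\<^sup>2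
        \<le> F ut + 1/2 * (\<Sum>r\<in>UNIV. (proj_K (w + G ut) $ r)\<^sup>2 / d r) + \<alpha>/2 * (norm (ut - x0))\<^sup>2"
      using min unfolding is_arg_min_linorder q_def by blast
    have Ft: "F ut \<le> F xp + t * (F u - F xp)"
      using convex_onD[OF F, of t xp u] t xp u by (simp add: ut_def algebra_simps)
    \<comment> \<open>Inequality coordinates use convexity and monotonicity of the squared positive
      part; equality coordinates are affine and expand exactly.\<close>
    have sq: "(proj_K (w + G ut) $ r)\<^sup>2
        \<le> (proj_K q $ r)\<^sup>2 + 2 * proj_K q $ r * (t * \<Delta> $ r) + (t * \<Delta> $ r)\<^sup>2" for r
    proof (cases r rule: prod_sum_cases)
      case (1 i j)
      have "(w + G ut) $ r \<le> q $ r + t * \<Delta> $ r"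
        using convex_onD[OF G_Inl[of i j], of t xp u] t xp u 1
        by (simp add: ut_def q_def \<Delta>_def algebra_simps)
      then show ?thesis using max_zero_square_le 1 by simp
    next
      case (2 i l)
      have "(w + G ut) $ r = q $ r + t * \<Delta> $ r"
        using G_Inr[OF xp u, of "1 - t" t i l] t 2
        by (simp add: ut_def q_def \<Delta>_def algebra_simps)
      then show ?thesis using 2 by (simp add: power2_sum)
    qed
    have "(\<Sum>r\<in>UNIV. (proj_K (w + G ut) $ r)\<^sup>2 / d r) \<le>
        (\<Sum>r\<in>UNIV. (proj_K q $ r)\<^sup>2 / d r + 2 * t * (y $ r * \<Delta> $ r) + t\<^sup>2 * ((\<Delta> $ r)\<^sup>2 / d r))"
    proof (rule sum_mono)
      fix r
      have "(proj_K (w + G ut) $ r)\<^sup>2 / d r \<le>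
        ((proj_K q $ r)\<^sup>2 + 2 * proj_K q $ r * (t * \<Delta> $ r) + (t * \<Delta> $ r)\<^sup>2) / d r"
        using sq d[of r] by (simp add: divide_right_mono)
      also have "\<dots> = (proj_K q $ r)\<^sup>2 / d r + 2 * t * (y $ r * \<Delta> $ r) + t\<^sup>2 * ((\<Delta> $ r)\<^sup>2 / d r)"
        using d[of r] unfolding q_def y[of r, symmetric]
        by (simp add: field_simps power2_eq_square)
      finally show "(proj_K (w + G ut) $ r)\<^sup>2 / d r \<le> \<dots>" .
    qed
    also have "\<dots> = (\<Sum>r\<in>UNIV. (proj_K q $ r)\<^sup>2 / d r) + 2 * t * (y \<bullet> \<Delta>)
        + t\<^sup>2 * (\<Sum>r\<in>UNIV. (\<Delta> $ r)\<^sup>2 / d r)"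
      by (simp add: sum.distrib sum_distrib_left inner_vec_def)
    finally have Gt: "(\<Sum>r\<in>UNIV. (proj_K (w + G ut) $ r)\<^sup>2 / d r) \<le> \<dots>" .
    have "ut - x0 = (xp - x0) + t *\<^sub>R (u - xp)"
      by (simp add: ut_def algebra_simps)
    then have Nt: "(norm (ut - x0))\<^sup>2 =
        (norm (xp - x0))\<^sup>2 + 2 * t * ((xp - x0) \<bullet> (u - xp)) + t\<^sup>2 * (norm (u - xp))\<^sup>2"
      by (simp only: power2_norm_eq_inner) (simp add: inner_simps inner_commute power2_eq_square)
    have "0 \<le> t * ((F u - F xp + y \<bullet> \<Delta> + \<alpha> * ((xp - x0) \<bullet> (u - xp))) + t * c)"
      using opt Ft Gt unfolding Nt c_def by (simp add: algebra_simps power2_eq_square)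
    then show ?thesis using t by (simp add: zero_le_mult_iff)
  qed
  then show ?thesis unfolding \<Delta>_def by (rule nonneg_of_nonneg_add_small)
qed

section \<open>Block structure\<close>

lemma block_combination:
  "block b i (s *\<^sub>R u + t *\<^sub>R v) = s *\<^sub>R block b i u + t *\<^sub>R block b i v"
  by (simp add: block_def vec_eq_iff)

lemma convex_block_prod:
  assumes "\<And>i. convex (X i)"
  shows "convex (block_prod b X)"
  using assms by (auto simp: block_prod_def convex_def block_combination)

lemma convex_on_block:
  assumes "\<And>i. convex (X i)" "convex_on (X i) \<phi>"
  shows "convex_on (block_prod b X) (\<lambda>u. \<phi> (block b i u))"
  using assms convex_block_prod[OF assms(1)]
  by (auto simp: convex_on_def block_combination block_prod_def)

lemma convex_on_sum_functions:
  assumes "finite I" "convex C" "\<And>i. i \<in> I \<Longrightarrow> convex_on C (\<phi> i)"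
  shows "convex_on C (\<lambda>u. \<Sum>i\<in>I. \<phi> i u)"
  using assms by (induction I rule: finite_induct) (auto simp: convex_on_const intro: convex_on_add)

lemma convex_on_block_sum:
  assumes "\<And>i. convex (X i)" "\<And>i. convex_on (X i) (f i)"
  shows "convex_on (block_prod b X) (block_sum b f)"
  unfolding block_sum_def
  by (intro convex_on_sum_functions convex_block_prod convex_on_block assms finite)

lemma convex_on_average:
  assumes "convex_on C \<phi>" "k \<ge> 1" "\<And>l. l \<ge> 1 \<Longrightarrow> x l \<in> C"
  shows "real k * \<phi> ((1 / real k) *\<^sub>R (\<Sum>l=1..k. x l)) \<le> (\<Sum>l=1..k. \<phi> (x l))"
proof -
  have "\<phi> (\<Sum>l=1..k. (1 / real k) *\<^sub>R x l) \<le> (\<Sum>l=1..k. (1 / real k) * \<phi> (x l))"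
    using assms by (intro convex_on_sum[where C=C]) (auto simp: convex_on_imp_convex)
  then have "\<phi> ((1 / real k) *\<^sub>R (\<Sum>l=1..k. x l)) \<le> (1 / real k) * (\<Sum>l=1..k. \<phi> (x l))"
    by (simp only: scaleR_sum_right sum_distrib_left)
  then show ?thesis
    using assms(2) by (simp add: field_simps)
qed

lemma gtilde_Inl [simp]: "gtilde b g h u $ (i, Inl j) = g i (block b i u) $ j"
  and gtilde_Inr [simp]: "gtilde b g h u $ (i, Inr l) = h i (block b i u) $ l"
  by (simp_all add: gtilde_def stack_def)

lemma affine_map_on_combination:
  assumes "affine_map_on C h" "u \<in> C" "v \<in> C" "s + t = 1" "s *\<^sub>R u + t *\<^sub>R v \<in> C"
  shows "h (s *\<^sub>R u + t *\<^sub>R v) = s *\<^sub>R h u + t *\<^sub>R h v"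
proof -
  obtain L c where L: "linear L" "\<And>x. x \<in> C \<Longrightarrow> h x = L x + c"
    using assms(1) by (auto simp: affine_map_on_def)
  have "c = s *\<^sub>R c + t *\<^sub>R c" using assms(4) by (simp flip: scaleR_add_left)
  then show ?thesis using assms L(2)
    by (simp add: linear_add[OF L(1)] linear_scale[OF L(1)] algebra_simps)
qed

lemma gtilde_Inr_combination:
  assumes "\<And>i. convex (X i)" "\<And>i. affine_map_on (X i) (h i)"
    and "u \<in> block_prod b X" "v \<in> block_prod b X" "0 \<le> s" "0 \<le> t" "s + t = 1"
  shows "gtilde b g h (s *\<^sub>R u + t *\<^sub>R v) $ (i, Inr l)
    = s * gtilde b g h u $ (i, Inr l) + t * gtilde b g h v $ (i, Inr l)"
proof -
  have "block b i u \<in> X i" "block b i v \<in> X i" using assms(3,4) by (auto simp: block_prod_def)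
  moreover from this have "s *\<^sub>R block b i u + t *\<^sub>R block b i v \<in> X i"
    using assms(1)[of i] assms(5-7) by (simp add: convex_def)
  ultimately show ?thesis
    using affine_map_on_combination[OF assms(2)] assms(7) by (simp add: block_combination)
qed

text \<open>Membership in the cone makes the multipliers of the convex components nonnegative; the
  affine components tolerate either sign.\<close>

lemma convex_on_gtilde_inner:
  assumes X: "\<And>i. convex (X i)" and g: "\<And>i j. convex_on (X i) (\<lambda>u. g i u $ j)"
    and h: "\<And>i. affine_map_on (X i) (h i)" and a: "a \<in> cone_K"
  shows "convex_on (block_prod b X) (\<lambda>u. a \<bullet> gtilde b g h u)"
proof -
  have "convex_on (block_prod b X) (\<lambda>u. a $ r * gtilde b g h u $ r)" for r
  proof (cases r rule: prod_sum_cases)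
    case (1 i j)
    have "0 \<le> a $ r" using a 1 by (simp add: cone_K_def)
    then show ?thesis unfolding 1 gtilde_Inl
      by (intro convex_on_cmul convex_on_block[where \<phi>="\<lambda>u. g _ u $ _"] X g)
  next
    case (2 i l)
    have "a $ r * gtilde b g h (s *\<^sub>R u + t *\<^sub>R v) $ r
        = s * (a $ r * gtilde b g h u $ r) + t * (a $ r * gtilde b g h v $ r)"
      if "u \<in> block_prod b X" "v \<in> block_prod b X" "0 \<le> s" "0 \<le> t" "s + t = 1" for u v s t
      unfolding 2 using gtilde_Inr_combination[OF X h that, where g=g and i=i and l=l]
      by (simp only:) (simp add: algebra_simps)
    then show ?thesis
      using convex_block_prod[of X b, OF X] unfolding convex_on_def by simp
  qed
  then show ?thesis
    unfolding inner_vec_def inner_real_def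
    by (intro convex_on_sum_functions convex_block_prod X) auto
qed

text \<open>Identifies the multiplier terms of the Lagrangian with a single inner product in the
  stacked space.\<close>

lemma consensus_stack_inner_gtilde:
  "consensus (stack \<mu> \<nu>) \<bullet> gtilde b g h u = \<mu> \<bullet> block_sum b g u + \<nu> \<bullet> block_sum b h u"
  unfolding consensus_inner UNIV_Plus_UNIV[symmetric]
  by (subst sum.Plus) (simp_all add: stack_def block_sum_def inner_vec_def)

text \<open>Equal pairings with all consensus vectors make \<zeta> the average of \<open>q\<close>
  over the agents. Its entries thus inherit the signs of the summed constraints and pair
  nonpositively with the cone.\<close>

lemma inner_consensus_nonpos:
  fixes \<zeta> :: "real^('m::finite + 'p::finite)" and y q :: "real^('n::finite \<times> ('m + 'p))"
  assumes y: "y \<in> cone_K"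
    and q: "\<And>\<eta>. consensus \<eta> \<bullet> (consensus \<zeta> :: real^('n \<times> ('m + 'p))) = consensus \<eta> \<bullet> q"
    and Inl: "\<And>j. (\<Sum>i\<in>UNIV. q $ (i, Inl j)) \<le> 0" and Inr: "\<And>l. (\<Sum>i\<in>UNIV. q $ (i, Inr l)) = 0"
  shows "consensus \<zeta> \<bullet> y \<le> 0"
proof -
  have *: "real CARD('n) * \<zeta> $ c = (\<Sum>i\<in>UNIV. q $ (i, c))" for c
  proof -
    have "(\<Sum>e\<in>UNIV. axis c 1 $ e * s e) = s c" for s :: "'m + 'p \<Rightarrow> real"
      by (simp add: axis_def if_distrib if_distribR cong: if_cong)
    then show ?thesis using q[of "axis c 1"]
      unfolding consensus_inner by (simp add: consensus_def)
  qed
  have "\<zeta> $ c * (\<Sum>i\<in>UNIV. y $ (i, c)) \<le> 0" for c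
  proof (cases c)
    case (Inl j)
    have "real CARD('n) * \<zeta> $ c \<le> 0" unfolding * Inl by (rule assms(3))
    then have "\<zeta> $ c \<le> 0" by (simp add: mult_le_0_iff)
    moreover have "0 \<le> (\<Sum>i\<in>UNIV. y $ (i, c))"
      using y Inl by (simp add: cone_K_def sum_nonneg)
    ultimately show ?thesis by (rule mult_nonpos_nonneg)
  next
    case (Inr l)
    have "real CARD('n) * \<zeta> $ c = 0" unfolding * Inr by (rule assms(4))
    then show ?thesis by simp
  qed
  then show ?thesis unfolding consensus_inner by (simp add: sum_nonpos)
qed

section \<open>Convergence rate\<close>

theorem theorem5:
  fixes b :: "'d::finite \<Rightarrow> 'n::finite"
    and X :: "'n \<Rightarrow> (real^'d) set"
    and f :: "'n \<Rightarrow> real^'d \<Rightarrow> real"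
    and g :: "'n \<Rightarrow> real^'d \<Rightarrow> real^'m::finite"
    and h :: "'n \<Rightarrow> real^'d \<Rightarrow> real^'p::finite"
    and PA PH PHt :: "real^'n^'n"
    and A H Ht :: "real^('n \<times> ('m + 'p))^('n \<times> ('m + 'p))"
    and \<rho> \<alpha> C1 C2 R1 R2 :: real
    and xs :: "real^'d" and \<mu>s :: "real^'m" and \<nu>s :: "real^'p"
    and x xbar :: "nat \<Rightarrow> real^'d"
    and y z v :: "nat \<Rightarrow> real^('n \<times> ('m + 'p))"
    and ys :: "real^('m + 'p)" and zs vs :: "real^('n \<times> ('m + 'p))"
  assumes "\<rho> > 0" and "\<alpha> > 0"
    and X_sub: "\<And>i. X i \<subseteq> block_space b i"
    and X_convex: "\<And>i. convex (X i)"
    and f_convex: "\<And>i. convex_on (X i) (f i)"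
    and g_convex: "\<And>i j. convex_on (X i) (\<lambda>u. g i u $ j)"
    and h_affine: "\<And>i. affine_map_on (X i) (h i)"
    and solvable: "\<exists>u. cc_optimal b X f g h u"
    and slater: "slater X g h"
    and "psd PA" and "psd PH" and "psd PHt"
    and "posdef (PA + \<rho> *\<^sub>R PH)"
    and "psd (PH - PHt)"
    and "null_space PH = span {vec 1}" and "null_space PHt = span {vec 1}"
    and "diagonal_matrix (PA + \<rho> *\<^sub>R PH)"
    and A_eq: "A = kron PA (mat 1)"
    and H_eq: "H = kron PH (mat 1)"
    and Ht_eq: "Ht = kron PHt (mat 1)"
    and pd_opt: "primal_dual_optimal b X f g h xs \<mu>s \<nu>s"
    and gen: "pro_duca b X f g h \<rho> \<alpha> A H Ht x y z"
    and xbar_eq: "\<And>k. xbar k = (1 / real k) *\<^sub>R (\<Sum>l=1..k. x l)"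
    and ys_eq: "ys = stack \<mu>s \<nu>s"
    and zs_eq: "zs = pinv (psd_sqrt Ht) *v gtilde b g h xs"
    and v_eq: "\<And>k. v k = psd_sqrt Ht *v z k"
    and vs_eq: "vs = psd_sqrt Ht *v zs"
    and C1_eq: "C1 = sqrt (real CARD('n) * lambda_max PA) * norm ys"
    and C2_eq: "C2 = sqrt ((wnorm A (y 0) + C1)\<^sup>2 + \<alpha> * (norm (x 0 - xs))\<^sup>2
                           + 1 / \<rho> * (wnorm (pinv Ht) (v 0 - vs))\<^sup>2)"
    and R1_eq: "R1 = C1 * (wnorm A (y 0) + C1 + C2)"
    and R2_eq: "R2 = 1 / (2 * \<rho>) * (wnorm (pinv Ht) (v 0 - vs))\<^sup>2
                     + 1/2 * (wnorm A (y 0))\<^sup>2 + \<alpha>/2 * (norm (x 0 - xs))\<^sup>2"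
  shows "\<forall>k\<ge>1. - (R1 / real k) \<le> block_sum b f (xbar k) - block_sum b f xs \<and>
                block_sum b f (xbar k) - block_sum b f xs \<le> R2 / real k"
proof (intro allI impI)
  fix k :: nat assume k: "k \<ge> 1"
  let ?G = "gtilde b g h" and ?F = "block_sum b f" and ?P = "block_prod b X" and ?S = "psd_sqrt Ht"
  let ?a = "consensus ys :: real^('n \<times> ('m + 'p))"
  define D where "D = A + \<rho> *\<^sub>R H"
  define d where "d r = D $ r $ r" for r
  define V where "V k = (wnorm (pinv Ht) (v k - vs))\<^sup>2" for k

  \<comment> \<open>The lifted matrices and the diagonal matrix \<open>D\<close>\<close>
  have A: "psd A" and H: "psd H" and Ht: "psd Ht" and HHt: "psd (H - Ht)"
    using psd_kron_mat_one[OF \<open>psd PA\<close>] psd_kron_mat_one[OF \<open>psd PH\<close>]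
      psd_kron_mat_one[OF \<open>psd PHt\<close>] psd_kron_mat_one[OF \<open>psd (PH - PHt)\<close>]
    unfolding A_eq H_eq Ht_eq kron_diff_left by blast+
  have symS: "transpose ?S = ?S" by (rule psd_sym[OF psd_psd_sqrt[OF Ht]])

  have "PH *v vec 1 = 0" "PHt *v vec 1 = 0"
    using \<open>null_space PH = span {vec 1}\<close> \<open>null_space PHt = span {vec 1}\<close>
      span_base[of "vec 1" "{vec 1 :: real^'n}"] unfolding null_space_def by blast+
  then have H_cons: "H *v consensus \<eta> = 0" and Ht_cons: "Ht *v consensus \<eta> = 0" for \<eta>
    unfolding H_eq Ht_eq by (blast intro: kron_mat_one_consensus)+
  have S_cons: "?S *v consensus \<eta> = 0" for \<eta>
    by (simp only: psd_sqrt_kernel[OF Ht] Ht_cons)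

  have D_eq: "D = kron (PA + \<rho> *\<^sub>R PH) (mat 1)"
    unfolding D_def A_eq H_eq kron_add_left kron_scaleR_left ..
  have diagD: "diagonal_matrix D"
    using \<open>diagonal_matrix (PA + \<rho> *\<^sub>R PH)\<close> unfolding D_eq diagonal_matrix_def
    by (auto simp: kron_def mat_def)
  have dpos: "d r > 0" for r
  proof -
    have "0 < axis (fst r) 1 \<bullet> ((PA + \<rho> *\<^sub>R PH) *v axis (fst r) 1)"
      using \<open>posdef (PA + \<rho> *\<^sub>R PH)\<close> unfolding posdef_def by (simp add: axis_eq_0_iff)
    then show ?thesis
      unfolding d_def D_eq
      by (simp add: kron_def mat_def inner_axis' matrix_vector_mul_component column_def inner_axis)
  qed
  have inv_D: "(matrix_inv D *v u) $ r = u $ r / d r" for u r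
    unfolding d_def using dpos[unfolded d_def] by (intro matrix_inv_diagonal diagD) (metis less_irrefl)
  have mult_D: "(D *v u) $ r = d r * u $ r" for u r
  proof -
    have "D $ r $ s * u $ s = (if s = r then d r * u $ r else 0)" for s
      using diagD unfolding diagonal_matrix_def d_def by (metis mult_zero_left)
    then show ?thesis by (simp add: matrix_vector_mult_def)
  qed
  have wnorm_inv_D: "(wnorm (matrix_inv D) u)\<^sup>2 = (\<Sum>r\<in>UNIV. (u $ r)\<^sup>2 / d r)" for u
  proof -
    have "u \<bullet> (matrix_inv D *v u) = (\<Sum>r\<in>UNIV. (u $ r)\<^sup>2 / d r)"
      by (simp add: inner_vec_def inv_D power2_eq_square)
    moreover have "0 \<le> (\<Sum>r\<in>UNIV. (u $ r)\<^sup>2 / d r)"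
      using dpos by (intro sum_nonneg divide_nonneg_nonneg) (auto intro: less_imp_le)
    ultimately show ?thesis by (simp add: wnorm_def)
  qed

  have conv_P: "convex ?P" by (rule convex_block_prod[OF X_convex])
  have conv_F: "convex_on ?P ?F" by (rule convex_on_block_sum[OF X_convex f_convex])

  \<comment> \<open>Feasibility and the saddle point inequality\<close>
  have feas: "xs \<in> ?P" "\<And>j. block_sum b g xs $ j \<le> 0" "block_sum b h xs = 0"
    using pd_opt by (simp_all add: primal_dual_optimal_def cc_optimal_def is_arg_min_def cc_feasible_def)
  have \<mu>s: "0 \<le> \<mu>s $ j" for j
    using pd_opt by (simp add: primal_dual_optimal_def is_arg_max_def)
  have a_K: "?a \<in> cone_K"
    using \<mu>s by (simp add: cone_K_def consensus_def ys_eq stack_def)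
  \<comment> \<open>Zero duality gap makes \<open>?F xs\<close> the infimum of the Lagrangian at the
    optimal multipliers.\<close>
  have saddle: "?F xs \<le> ?F u + ?a \<bullet> ?G u" if "u \<in> ?P" for u
  proof -
    have "ereal (?F xs) \<le> ereal (lagrangian b f g h \<mu>s \<nu>s u)"
      using pd_opt that unfolding primal_dual_optimal_def dual_fun_def by (metis INF_lower)
    then show ?thesis by (simp add: lagrangian_def ys_eq consensus_stack_inner_gtilde add.assoc)
  qed

  \<comment> \<open>The iteration in coordinates\<close>
  note gen' = gen[unfolded pro_duca_def Let_def D_def[symmetric], THEN conjunct2, rule_format]
  define w where "w l = A *v y l - v l" for l
  have x_min: "is_arg_min (\<lambda>u. ?F u + 1/2 * (\<Sum>r\<in>UNIV. (proj_K (w l + ?G u) $ r)\<^sup>2 / d r)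
      + \<alpha>/2 * (norm (u - x l))\<^sup>2) (\<lambda>u. u \<in> ?P) (x (Suc l))" for l
    using gen'[of l] unfolding wnorm_inv_D closest_point_cone_K w_def v_eq by blast
  have y_Suc: "d r * y (Suc l) $ r = proj_K (w l + ?G (x (Suc l))) $ r" for l r
  proof -
    have "y (Suc l) $ r = proj_K (matrix_inv D *v (w l + ?G (x (Suc l)))) $ r"
      using gen'[of l] unfolding closest_point_cone_K w_def v_eq by simp
    then show ?thesis
      using dpos[of r] by (cases r rule: prod_sum_cases) (simp_all add: inv_D max_def field_simps)
  qed
  have v_Suc: "v (Suc l) = v l + \<rho> *\<^sub>R (Ht *v y (Suc l))" for l
    using gen'[of l] unfolding v_eq
    by (simp add: matrix_vector_right_distrib matrix_vector_mult_scaleR psd_sqrt_mult_vec[OF Ht])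
  have x_P: "x (Suc l) \<in> ?P" for l using x_min[of l] by (simp add: is_arg_min_def)
  have y_K: "y (Suc l) \<in> cone_K" for l
    using gen'[of l] unfolding closest_point_cone_K by (simp add: proj_K_in_cone_K)

  \<comment> \<open>Inequalities satisfied by one iteration\<close>
  have prox: "?F (x (Suc l)) - ?F xs \<le> y (Suc l) \<bullet> (?G xs - ?G (x (Suc l)))
      + \<alpha> * ((x (Suc l) - x l) \<bullet> (xs - x (Suc l)))" for l
  proof -
    have "0 \<le> ?F xs - ?F (x (Suc l)) + y (Suc l) \<bullet> (?G xs - ?G (x (Suc l)))
        + \<alpha> * ((x (Suc l) - x l) \<bullet> (xs - x (Suc l)))"
    proof (rule prox_step_optimality[OF conv_F _ _ dpos x_min feas(1) y_Suc])
      show "convex_on ?P (\<lambda>u. ?G u $ (i, Inl j))" for i j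
        unfolding gtilde_Inl by (intro convex_on_block[where \<phi>="\<lambda>u. g i u $ j"] X_convex g_convex)
    qed (rule gtilde_Inr_combination[OF X_convex h_affine])
    then show ?thesis by simp
  qed
  \<comment> \<open>Substituting \<open>D = A + \<rho> *\<^sub>R H\<close> separates the
    \<open>A\<close> difference from the terms in \<open>v\<close> and \<open>H\<close>, which are
    orthogonal to consensus vectors.\<close>
  have residual: "w l + ?G (x (Suc l)) - proj_K (w l + ?G (x (Suc l)))
      = ?G (x (Suc l)) - A *v (y (Suc l) - y l) - v l - \<rho> *\<^sub>R (H *v y (Suc l))" for l
  proof -
    have "proj_K (w l + ?G (x (Suc l))) = D *v y (Suc l)"
      by (simp add: vec_eq_iff mult_D y_Suc)
    then show ?thesis
      by (simp add: D_def w_def matrix_vector_mult_add_rdistrib matrix_vector_mult_diff_distrib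
          scaleR_matrix_vector_assoc)
  qed
  have v_cons: "v l \<bullet> consensus \<eta> = 0" and H_cons': "(H *v u) \<bullet> consensus \<eta> = 0" for l \<eta> u
    by (simp_all add: v_eq symmetric_inner[OF symS] S_cons symmetric_inner[OF psd_sym[OF H]] H_cons)
  have polar: "consensus \<eta> \<bullet> ?G (x (Suc l)) - y (Suc l) \<bullet> ?G (x (Suc l))
      \<le> (A *v (y (Suc l) - y l)) \<bullet> (consensus \<eta> - y (Suc l)) - v l \<bullet> y (Suc l)
        - \<rho> * (y (Suc l) \<bullet> (H *v y (Suc l)))"
    if "consensus \<eta> \<in> (cone_K :: (real^('n \<times> ('m + 'p))) set)" for \<eta> l
    using scaled_proj_K_polar(1)[where d=d, OF dpos that y_Suc[of _ l]] v_cons[of l \<eta>] H_cons'[of _ \<eta>]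
    unfolding residual by (simp add: inner_diff_left inner_diff_right inner_commute)
  \<comment> \<open>Here polarity is tested with \<open>?a\<close> itself, so that only the
    difference in \<open>A\<close> remains and the bound telescopes.\<close>
  have infeasibility: "?a \<bullet> ?G (x (Suc l)) \<le> ?a \<bullet> (A *v (y (Suc l) - y l))" for l
    using scaled_proj_K_polar(2)[where d=d, OF dpos a_K y_Suc[of _ l]] v_cons[of l ys] H_cons'[of _ ys]
    unfolding residual by (simp add: inner_diff_left inner_diff_right inner_commute)

  have v_star: "y (Suc l) \<bullet> ?G xs \<le> y (Suc l) \<bullet> vs" for l
  proof -
    \<comment> \<open>The part of \<open>?G xs\<close> outside the range of \<open>Ht\<close> is the consensus vector of the averaged
      constraint values, whose inequality entries are nonpositive and equality entries zero.\<close>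
    define q where "q = ?G xs - vs"
    \<comment> \<open>\<open>vs\<close> is the orthogonal projection of \<open>?G xs\<close> onto
      the range of \<open>?S\<close>, so the remainder lies in the kernel.\<close>
    have "?S *v q = 0"
      unfolding q_def vs_eq zs_eq by (simp only: matrix_vector_mult_diff_distrib mult_mult_pinv[OF symS]) simp
    then have "Ht *v q = 0" using psd_sqrt_mult_vec[OF Ht, of q] by simp
    then obtain \<zeta> where \<zeta>: "q = consensus \<zeta>"
      using kron_mat_one_kernel[of PHt q] \<open>null_space PHt = span {vec 1}\<close> unfolding Ht_eq by blast
    have "consensus \<eta> \<bullet> q = consensus \<eta> \<bullet> ?G xs" for \<eta>
      unfolding q_def vs_eq inner_diff_right
      using symmetric_inner[OF symS, of "consensus \<eta>" zs] S_cons[of \<eta>] by simp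
    moreover have "(\<Sum>i\<in>UNIV. ?G xs $ (i, Inl j)) \<le> 0" for j
      using feas(2)[of j] by (simp add: block_sum_def)
    moreover have "(\<Sum>i\<in>UNIV. ?G xs $ (i, Inr j)) = 0" for j
      using arg_cong[OF feas(3), of "\<lambda>u. u $ j"] by (simp add: block_sum_def)
    ultimately have "consensus \<zeta> \<bullet> y (Suc l) \<le> 0"
      unfolding \<zeta> by (intro inner_consensus_nonpos[OF y_K])
    then show ?thesis unfolding \<zeta>[symmetric] q_def by (simp add: inner_diff_left inner_diff_right inner_commute)
  qed
  \<comment> \<open>The expansion of the pseudoinverse norm is solved for its cross term; the
    leftover \<open>Ht\<close> term is absorbed later by the \<open>H\<close> term of
    \<open>polar\<close>.\<close>
  have V_Suc: "- ((v l - vs) \<bullet> y (Suc l))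
      = (V l - V (Suc l)) / (2 * \<rho>) + \<rho> / 2 * (y (Suc l) \<bullet> (Ht *v y (Suc l)))" for l
  proof -
    have "v (Suc l) - vs = (v l - vs) + \<rho> *\<^sub>R (Ht *v y (Suc l))" by (simp add: v_Suc)
    moreover have "v l - vs = ?S *v (z l - zs)"
      by (simp add: v_eq vs_eq matrix_vector_mult_diff_distrib)
    ultimately have "V (Suc l) = V l + 2 * \<rho> * ((v l - vs) \<bullet> y (Suc l))
        + \<rho>\<^sup>2 * (y (Suc l) \<bullet> (Ht *v y (Suc l)))"
      unfolding V_def by (simp only: wnorm_pinv_step[OF Ht])
    then show ?thesis using \<open>\<rho> > 0\<close> by (simp add: field_simps power2_eq_square)
  qed
  \<comment> \<open>The two sides differ by half the squared \<open>A\<close>-seminorm of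
    \<open>u - w\<close>, which is discarded.\<close>
  have three_point: "(A *v (u - w)) \<bullet> (e - u) \<le> 1/2 * ((wnorm A (w - e))\<^sup>2 - (wnorm A (u - e))\<^sup>2)" for u w e
  proof -
    have "0 \<le> (u - w) \<bullet> (A *v (u - w))" by (rule psd_nonneg[OF A])
    moreover have "u \<bullet> (A *v w) = w \<bullet> (A *v u)" "u \<bullet> (A *v e) = e \<bullet> (A *v u)" "w \<bullet> (A *v e) = e \<bullet> (A *v w)"
      using symmetric_inner[OF psd_sym[OF A]] by (simp_all add: inner_commute)
    ultimately show ?thesis
      unfolding wnorm_power2[OF A] symmetric_inner[OF psd_sym[OF A]] matrix_vector_mult_diff_distrib
        inner_diff_left inner_diff_right by argo
  qed
  have three_point_x: "(u - w) \<bullet> (xs - u) \<le> 1/2 * ((norm (w - xs))\<^sup>2 - (norm (u - xs))\<^sup>2)" for u w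
  proof -
    have "0 \<le> (u - w) \<bullet> (u - w)" by simp
    then show ?thesis unfolding power2_norm_eq_inner inner_diff_left inner_diff_right
      using inner_commute[of u w] inner_commute[of u xs] inner_commute[of w xs] by argo
  qed

  \<comment> \<open>Energy decrease and telescoping\<close>
  define E where "E a l = \<alpha>/2 * (norm (x l - xs))\<^sup>2 + 1/2 * (wnorm A (y l - a))\<^sup>2 + V l / (2 * \<rho>)" for a l
  have step: "?F (x (Suc l)) - ?F xs + consensus \<eta> \<bullet> ?G (x (Suc l)) \<le> E (consensus \<eta>) l - E (consensus \<eta>) (Suc l)"
    if \<eta>: "consensus \<eta> \<in> (cone_K :: (real^('n \<times> ('m + 'p))) set)" for \<eta> l
  proof -
    have "0 \<le> y (Suc l) \<bullet> (H *v y (Suc l))" "0 \<le> y (Suc l) \<bullet> ((H - Ht) *v y (Suc l))"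
      using psd_nonneg[OF H] psd_nonneg[OF HHt] by blast+
    \<comment> \<open>The \<open>Ht\<close> form is at most the \<open>H\<close> form, and
      nonnegativity of the latter allows the factor two that matches the term in
      \<open>polar\<close>.\<close>
    then have "\<rho> / 2 * (y (Suc l) \<bullet> (Ht *v y (Suc l))) \<le> \<rho> / 2 * (2 * (y (Suc l) \<bullet> (H *v y (Suc l))))"
      using \<open>\<rho> > 0\<close> by (intro mult_left_mono) (simp_all add: matrix_vector_mult_diff_rdistrib inner_diff_right)
    moreover have "\<alpha> * ((x (Suc l) - x l) \<bullet> (xs - x (Suc l)))
        \<le> \<alpha> * (1/2 * ((norm (x l - xs))\<^sup>2 - (norm (x (Suc l) - xs))\<^sup>2))"
      using three_point_x \<open>\<alpha> > 0\<close> by simp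
    ultimately show ?thesis
      using prox[of l] polar[OF \<eta>, of l] v_star[of l] V_Suc[of l] three_point[of "y (Suc l)" "y l" "consensus \<eta>"]
      unfolding E_def by (simp add: inner_diff_right inner_diff_left inner_commute algebra_simps diff_divide_distrib)
  qed
  have telescope: "(\<Sum>l=1..k. ?F (x l) - ?F xs + consensus \<eta> \<bullet> ?G (x l)) \<le> E (consensus \<eta>) 0 - E (consensus \<eta>) k"
    if "consensus \<eta> \<in> (cone_K :: (real^('n \<times> ('m + 'p))) set)" for \<eta> k
  proof (induction k)
    case (Suc k)
    then show ?case using step[OF that, of k] by simp
  qed simp
  have E_lower: "1/2 * (wnorm A (y l - a))\<^sup>2 \<le> E a l" for a l
    using \<open>\<alpha> > 0\<close> \<open>\<rho> > 0\<close> by (simp add: E_def V_def)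

  \<comment> \<open>The starting point \<open>x 0\<close> may lie outside \<open>?P\<close>, so sums
    and averages begin at index one.\<close>
  have x_in: "x l \<in> ?P" if "l \<ge> 1" for l using x_P[of "l - 1"] that by simp
  have xbar_P: "xbar k \<in> ?P"
    unfolding xbar_eq scaleR_sum_right using k by (intro convex_sum conv_P x_in) auto
  have F_bar: "real k * ?F (xbar k) \<le> (\<Sum>l=1..k. ?F (x l))"
    unfolding xbar_eq by (rule convex_on_average[OF conv_F k x_in])
  have G_bar: "real k * (?a \<bullet> ?G (xbar k)) \<le> (\<Sum>l=1..k. ?a \<bullet> ?G (x l))"
    unfolding xbar_eq
    by (rule convex_on_average[OF convex_on_gtilde_inner[OF X_convex g_convex h_affine a_K] k x_in])

  \<comment> \<open>Upper bound\<close>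
  have "real k * (?F (xbar k) - ?F xs) \<le> R2"
  proof -
    have zero: "consensus 0 = (0 :: real^('n \<times> ('m + 'p)))" by (simp add: consensus_def vec_eq_iff)
    have "(\<Sum>l=1..k. ?F (x l) - ?F xs) \<le> E 0 0 - E 0 k"
      using telescope[of 0 k] unfolding zero by (simp add: cone_K_def)
    also have "\<dots> \<le> E 0 0" using E_lower[of k 0] zero_le_power2[of "wnorm A (y k - 0)"] by linarith
    also have "E 0 0 = R2" by (simp add: E_def R2_eq V_def)
    finally show ?thesis using F_bar by (simp add: sum_subtractf algebra_simps)
  qed

  \<comment> \<open>Lower bound\<close>
  moreover have "- R1 \<le> real k * (?F (xbar k) - ?F xs)"
  proof -
    have "(wnorm A ?a)\<^sup>2 \<le> real CARD('n) * lambda_max PA * (ys \<bullet> ys)"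
      unfolding wnorm_power2[OF A] unfolding A_eq by (rule consensus_quadratic_le[OF psd_sym[OF \<open>psd PA\<close>]])
    then have "sqrt ((wnorm A ?a)\<^sup>2) \<le> C1"
      unfolding C1_eq by (metis norm_eq_sqrt_inner real_sqrt_le_mono real_sqrt_mult)
    then have a_C1: "wnorm A ?a \<le> C1" by simp
    have wA: "0 \<le> wnorm A u" for u by (simp add: wnorm_eq_norm_sqrt[OF A])
    \<comment> \<open>Each summand is nonnegative by \<open>saddle\<close>, so the energy at
      \<open>k\<close> does not exceed the initial energy, which is at most half of
      \<open>C2\<close> squared.\<close>
    have "0 \<le> (\<Sum>l=1..k. ?F (x l) - ?F xs + ?a \<bullet> ?G (x l))"
      using saddle x_in by (intro sum_nonneg) (simp add: algebra_simps)
    then have "1/2 * (wnorm A (y k - ?a))\<^sup>2 \<le> E ?a 0"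
      using telescope[OF a_K, of k] E_lower[of k ?a] by linarith
    also have "E ?a 0 \<le> 1/2 * ((wnorm A (y 0) + C1)\<^sup>2 + \<alpha> * (norm (x 0 - xs))\<^sup>2
                           + 1 / \<rho> * (wnorm (pinv Ht) (v 0 - vs))\<^sup>2)"
    proof -
      have "wnorm A (y 0 - ?a) \<le> wnorm A (y 0) + C1"
        using wnorm_diff_le[OF A, of "y 0" ?a] a_C1 by linarith
      then have "(wnorm A (y 0 - ?a))\<^sup>2 \<le> (wnorm A (y 0) + C1)\<^sup>2"
        by (rule power_mono) (rule wA)
      then show ?thesis by (simp add: E_def V_def)
    qed
    finally have "(wnorm A (y k - ?a))\<^sup>2 \<le> (wnorm A (y 0) + C1)\<^sup>2 + \<alpha> * (norm (x 0 - xs))\<^sup>2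
                           + 1 / \<rho> * (wnorm (pinv Ht) (v 0 - vs))\<^sup>2" by simp
    then have "wnorm A (y k - ?a) \<le> C2" unfolding C2_eq by (rule real_le_rsqrt)
    then have yk: "wnorm A (y k) \<le> C1 + C2"
      using wnorm_add_le[OF A, of "y k - ?a" ?a] a_C1 by simp

    \<comment> \<open>The accumulated violation in direction \<open>?a\<close> is controlled by the
      total displacement of \<open>y\<close>, which stays bounded in the \<open>A\<close>-seminorm
      independently of \<open>k\<close>.\<close>
    have tele: "(\<Sum>l=1..k. ?a \<bullet> ?G (x l)) \<le> ?a \<bullet> (A *v (y k - y 0))" for k
    proof (induction k)
      case (Suc k)
      then show ?case using infeasibility[of k]
        by (simp add: matrix_vector_mult_diff_distrib inner_diff_right)
    qed simp
    have "real k * (?F xs - ?F (xbar k)) \<le> real k * (?a \<bullet> ?G (xbar k))"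
      using saddle[OF xbar_P] by (intro mult_left_mono) auto
    also have "\<dots> \<le> ?a \<bullet> (A *v (y k - y 0))" using G_bar tele[of k] by linarith
    also have "\<dots> \<le> wnorm A ?a * wnorm A (y k - y 0)" by (rule wnorm_Cauchy_Schwarz[OF A])
    also have "\<dots> \<le> C1 * (wnorm A (y 0) + C1 + C2)"
      using wnorm_diff_le[OF A, of "y k" "y 0"] yk a_C1 wA wA[of ?a] by (intro mult_mono) (auto intro: order_trans)
    finally show ?thesis unfolding R1_eq by (simp add: algebra_simps)
  qed
  ultimately show "- (R1 / real k) \<le> ?F (xbar k) - ?F xs \<and> ?F (xbar k) - ?F xs \<le> R2 / real k"
    using k by (simp add: field_simps)
qed

end
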